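(* Let $G$ be a finite simple connected graph, let $K$ be a field, and let $w$ be an even closed walk of $G$ with $B_w\neq 0$. Then the binomial $B_w$ is fundamental if and only if $w$ is a circuit (that is, $B_w$ is a circuit of $I_G$) and $w$ has no chords, except in the case that $w$ is a cycle, in which case $w$ is required to have no even chords and at most one odd chord.
   Context: Toric ideal. Let $V(G)=\{v_1,\ldots,v_n\}$ and $E(G)=\{e_1,\ldots,e_m\}$; the edges are also the variables of $K[e_1,\ldots,e_m]$. To $e=\{v_i,v_j\}$ associate $a_e=v_i+v_j$ in the free abelian group on $V(G)$. The toric ideal $I_G\subset K[e_1,\ldots,e_m]$ is generated by all binomials $\mathbf{e}^{\mathbf{u}}-\mathbf{e}^{\mathbf{v}}$ with $\sum_k u_k a_{e_k}=\sum_k v_k a_{e_k}$. The support of a binomial is the set of variables dividing at least one of its two monomials. An irreducible binomial $B\in I_G$ is a circuit of $I_G$ if there is no (nonzero) binomial $B'\in I_G$ whose support is properly contained in the support of $B$. Walks. A walk is a finite sequence of edges $w=(\{v_{i_1},v_{i_2}\},\{v_{i_2},v_{i_3}\},\ldots,\{v_{i_q},v_{i_{q+1}}\})$ of $G$, $q\ge1$; its length is $q$, it is even/odd according to $q$, and closed if $v_{i_{q+1}}=v_{i_1}$. Edges may be repeated. A cycle is a closed walk with $v_{i_k}\ne v_{i_j}$ for all $1\le k<j\le q$. For an even closed walk $w=(e_{i_1},\ldots,e_{i_{2q}})$ put $B_w=\prod_{k=1}^{q}e_{i_{2k-1}}-\prod_{k=1}^{q}e_{i_{2k}}\in I_G$.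 $\mathbf{w}$ denotes the subgraph of $G$ whose vertices and edges are those of $w$, and $G_w$ denotes the induced subgraph of $G$ on the vertex set $V(\mathbf{w})$. An even closed walk $w$ of $G$ is fundamental if for every even closed walk $w'$ of $G_w$ one has $B_{w'}\in\langle B_w\rangle$ (the ideal generated by $B_w$); the binomial $B_w$ is fundamental if $w$ is fundamental. Chords. An edge $f\in E(G)$ is a chord of $w$ if both vertices of $f$ are vertices of $\mathbf{w}$ and $f\notin E(\mathbf{w})$. For $w=((v_1,v_2),\ldots,(v_{2k},v_1))$ with $e_s=(v_s,v_{s+1})$ and $e_{2k}=(v_{2k},v_1)$, a chord $f=\{v_i,v_j\}$, $i<j$, breaks $w$ into the two walks $(e_1,\ldots,e_{i-1},f,e_j,\ldots,e_{2k})$ and $(e_i,\ldots,e_{j-1},f)$, which are both even or both odd. When $w$ is an even cycle, a chord of $w$ is even (respectively odd) if it breaks $w$ into two even (respectively two odd) walks. *)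

theory Defs
  imports Complex_Main "HOL-Library.Poly_Mapping" "HOL-Computational_Algebra.Factorial_Ring"
begin

text \<open>
  A finite simple graph is given by its incidence function \<open>ends :: 'e::finite \<Rightarrow> 'v::finite set\<close>:
  the vertex set is the type \<open>'v\<close>, the edge set is the type \<open>'e\<close>, and simplicity says that every
  edge has exactly two ends (no loops) and is determined by them (no multiple edges).  With this
  encoding the type \<open>('e \<Rightarrow>\<^sub>0 nat) \<Rightarrow>\<^sub>0 'k\<close> is exactly the polynomial ring
  \<open>K[e\<^sub>1, \<dots>, e\<^sub>m]\<close> whose variables are the edges of the graph.
\<close>

definition simple_graph :: "('e::finite \<Rightarrow> 'v::finite set) \<Rightarrow> bool" where
  "simple_graph ends \<longleftrightarrow> inj ends \<and> (\<forall>e. card (ends e) = 2)"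

text \<open>
  A walk is represented by its list of edges \<open>es\<close> (of length \<open>q \<ge> 1\<close>) together with the list
  \<open>vs\<close> of the \<open>q + 1\<close> vertices it passes through.
\<close>

definition walk :: "('e::finite \<Rightarrow> 'v::finite set) \<Rightarrow> 'v list \<Rightarrow> 'e list \<Rightarrow> bool" where
  "walk ends vs es \<longleftrightarrow> es \<noteq> [] \<and> length vs = Suc (length es) \<and>
     (\<forall>k<length es. ends (es ! k) = {vs ! k, vs ! Suc k})"

definition connected_graph :: "('e::finite \<Rightarrow> 'v::finite set) \<Rightarrow> bool" where
  "connected_graph ends \<longleftrightarrow>
     (\<forall>x y. x \<noteq> y \<longrightarrow> (\<exists>vs es. walk ends vs es \<and> hd vs = x \<and> last vs = y))"

definition closed_walk :: "('e::finite \<Rightarrow> 'v::finite set) \<Rightarrow> 'v list \<Rightarrow> 'e list \<Rightarrow> bool" where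
  "closed_walk ends vs es \<longleftrightarrow> walk ends vs es \<and> last vs = hd vs"

definition even_closed_walk :: "('e::finite \<Rightarrow> 'v::finite set) \<Rightarrow> 'v list \<Rightarrow> 'e list \<Rightarrow> bool" where
  "even_closed_walk ends vs es \<longleftrightarrow> closed_walk ends vs es \<and> even (length es)"

definition is_cycle :: "('e::finite \<Rightarrow> 'v::finite set) \<Rightarrow> 'v list \<Rightarrow> 'e list \<Rightarrow> bool" where
  "is_cycle ends vs es \<longleftrightarrow> closed_walk ends vs es \<and> distinct (butlast vs)"

definition induced_edges :: "('e::finite \<Rightarrow> 'v::finite set) \<Rightarrow> 'v set \<Rightarrow> 'e set" where
  "induced_edges ends S = {e. ends e \<subseteq> S}"

definition chord :: "('e::finite \<Rightarrow> 'v::finite set) \<Rightarrow> 'v list \<Rightarrow> 'e list \<Rightarrow> 'e \<Rightarrow> bool" where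
  "chord ends vs es f \<longleftrightarrow> ends f \<subseteq> set vs \<and> f \<notin> set es"

text \<open>
  Positions are counted from 0, so for \<open>f = {v\<^sub>i, v\<^sub>j}\<close> with \<open>i < j\<close> the two walks
  \<open>(e\<^sub>1, \<dots>, e\<^bsub>i-1\<^esub>, f, e\<^sub>j, \<dots>, e\<^bsub>2k\<^esub>)\<close> and \<open>(e\<^sub>i, \<dots>, e\<^bsub>j-1\<^esub>, f)\<close> become the lists below.
\<close>

definition breaks_into ::
  "('e::finite \<Rightarrow> 'v::finite set) \<Rightarrow> 'v list \<Rightarrow> 'e list \<Rightarrow> 'e \<Rightarrow> 'e list \<Rightarrow> 'e list \<Rightarrow> bool" where
  "breaks_into ends vs es f w1 w2 \<longleftrightarrow>
     (\<exists>i j. i < j \<and> j < length es \<and> ends f = {vs ! i, vs ! j} \<and>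
        w1 = take i es @ [f] @ drop j es \<and>
        w2 = drop i (take j es) @ [f])"

definition even_chord :: "('e::finite \<Rightarrow> 'v::finite set) \<Rightarrow> 'v list \<Rightarrow> 'e list \<Rightarrow> 'e \<Rightarrow> bool" where
  "even_chord ends vs es f \<longleftrightarrow> chord ends vs es f \<and>
     (\<exists>w1 w2. breaks_into ends vs es f w1 w2 \<and> even (length w1) \<and> even (length w2))"

definition odd_chord :: "('e::finite \<Rightarrow> 'v::finite set) \<Rightarrow> 'v list \<Rightarrow> 'e list \<Rightarrow> 'e \<Rightarrow> bool" where
  "odd_chord ends vs es f \<longleftrightarrow> chord ends vs es f \<and>
     (\<exists>w1 w2. breaks_into ends vs es f w1 w2 \<and> odd (length w1) \<and> odd (length w2))"

type_synonym ('e, 'k) edge_poly = "('e \<Rightarrow>\<^sub>0 nat) \<Rightarrow>\<^sub>0 'k"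

definition ideal_gen :: "'a::comm_ring_1 set \<Rightarrow> 'a set" where
  "ideal_gen S = module.span (*) S"

text \<open>
  \<open>module.span\<close> is meaningful only for a module; the following lemma makes its theory available
  for \<open>ideal_gen\<close>.
\<close>

lemma module_ring_mult: "module ((*) :: 'a::comm_ring_1 \<Rightarrow> 'a \<Rightarrow> 'a)"
  by unfold_locales (simp_all add: algebra_simps)

definition monomial :: "('e \<Rightarrow>\<^sub>0 nat) \<Rightarrow> ('e, 'k::field) edge_poly" where
  "monomial u = Poly_Mapping.single u 1"

definition edge_var :: "'e \<Rightarrow> ('e, 'k::field) edge_poly" where
  "edge_var e = monomial (Poly_Mapping.single e 1)"

text \<open>\<open>a\<^sub>e\<close>, an element of the free abelian group \<open>'v \<Rightarrow>\<^sub>0 int\<close> on the vertices.\<close>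

definition edge_vec :: "('e::finite \<Rightarrow> 'v::finite set) \<Rightarrow> 'e \<Rightarrow> ('v \<Rightarrow>\<^sub>0 int)" where
  "edge_vec ends e = (\<Sum>v\<in>ends e. frag_of v)"

definition graph_degree :: "('e::finite \<Rightarrow> 'v::finite set) \<Rightarrow> ('e \<Rightarrow>\<^sub>0 nat) \<Rightarrow> ('v \<Rightarrow>\<^sub>0 int)" where
  "graph_degree ends u = (\<Sum>e\<in>UNIV. frag_cmul (int (Poly_Mapping.lookup u e)) (edge_vec ends e))"

definition toric_ideal :: "('e::finite \<Rightarrow> 'v::finite set) \<Rightarrow> ('e, 'k::field) edge_poly set" where
  "toric_ideal ends =
     ideal_gen {monomial u - monomial v |u v. graph_degree ends u = graph_degree ends v}"

definition is_binomial :: "('e, 'k::field) edge_poly \<Rightarrow> bool" where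
  "is_binomial B \<longleftrightarrow> (\<exists>u v. B = monomial u - monomial v)"

text \<open>
  The variables dividing some monomial of \<open>p\<close>; a nonzero binomial has exactly its two monomials
  as keys.
\<close>

definition poly_supp :: "('e, 'k::field) edge_poly \<Rightarrow> 'e set" where
  "poly_supp p = (\<Union>m\<in>Poly_Mapping.keys p. Poly_Mapping.keys m)"

definition is_circuit :: "('e::finite \<Rightarrow> 'v::finite set) \<Rightarrow> ('e, 'k::field) edge_poly \<Rightarrow> bool" where
  "is_circuit ends B \<longleftrightarrow> is_binomial B \<and> irreducible B \<and> B \<in> toric_ideal ends \<and>
     \<not> (\<exists>B' :: ('e, 'k) edge_poly. is_binomial B' \<and> B' \<noteq> 0 \<and> B' \<in> toric_ideal ends \<and>
           poly_supp B' \<subset> poly_supp B)"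

text \<open>The odd-numbered edges of the walk are those at even positions of the list.\<close>

definition walk_binomial :: "'e list \<Rightarrow> ('e, 'k::field) edge_poly" where
  "walk_binomial es =
     (\<Prod>k<length es div 2. edge_var (es ! (2 * k))) -
     (\<Prod>k<length es div 2. edge_var (es ! (2 * k + 1)))"

text \<open>The first argument only carries the coefficient field.\<close>

definition fundamental_walk ::
  "'k::field itself \<Rightarrow> ('e::finite \<Rightarrow> 'v::finite set) \<Rightarrow> 'v list \<Rightarrow> 'e list \<Rightarrow> bool" where
  "fundamental_walk K ends vs es \<longleftrightarrow> even_closed_walk ends vs es \<and>
     (\<forall>vs' es'. even_closed_walk ends vs' es' \<and> set es' \<subseteq> induced_edges ends (set vs) \<longrightarrow>
        (walk_binomial es' :: ('e, 'k) edge_poly) \<in> ideal_gen {walk_binomial es})"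

definition fundamental_binomial ::
  "('e::finite \<Rightarrow> 'v::finite set) \<Rightarrow> ('e, 'k::field) edge_poly \<Rightarrow> bool" where
  "fundamental_binomial ends B \<longleftrightarrow>
     (\<exists>vs es. fundamental_walk TYPE('k) ends vs es \<and> B = walk_binomial es)"

end

theory Submission
  imports Defs
begin

text \<open>
  Write \<open>B\<^sub>w\<close> as \<open>e\<^sup>a - e\<^sup>b\<close>.  Both sides of the equivalence say that every balanced integer edge
  weight coming from an even closed walk of \<open>G\<^sub>w\<close> is an integer multiple of \<open>a - b\<close>, and that \<open>a\<close> and
  \<open>b\<close> are coprime and \<open>a - b\<close> is primitive.  Ideal membership of a binomial is read off from any
  congruence on exponents that identifies the generators.  A binomial is irreducible if and only if its
  exponents are coprime and their difference is primitive: the Newton polytopes of two factors are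
  parallel lattice segments whose lengths add up to that of the primitive segment from \<open>a\<close> to \<open>b\<close>.

  Any nonzero balanced weight carries an even closed walk alternating between its positive and its
  negative edges.  If \<open>w\<close> is fundamental, this gives coprimality and minimality of the support; that
  \<open>a - b\<close> is primitive holds because \<open>w\<close> has no proper even closed segment.  A chord \<open>f\<close> cannot lie on
  an even closed walk of \<open>G\<^sub>w\<close> that uses \<open>f\<close> once, and parity of distances along \<open>w\<close> produces such a
  walk from an even chord, from a second chord, and from any chord if \<open>w\<close> repeats a vertex.
\<close>

section \<open>Edge polynomials as finite sums of monomials\<close>

lemma poly_mapping_sum_singles:
  "(\<Sum>k\<in>Poly_Mapping.keys p. Poly_Mapping.single k (Poly_Mapping.lookup p k)) = p"
proof (rule poly_mapping_eqI)
  fix k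
  have "(\<Sum>l\<in>Poly_Mapping.keys p. Poly_Mapping.lookup p l when l = k) =
    (\<Sum>l\<in>Poly_Mapping.keys p. if l = k then Poly_Mapping.lookup p l else 0)"
    by (intro sum.cong) auto
  then show "Poly_Mapping.lookup (\<Sum>l\<in>Poly_Mapping.keys p.
      Poly_Mapping.single l (Poly_Mapping.lookup p l)) k = Poly_Mapping.lookup p k"
    by (simp add: lookup_sum lookup_single in_keys_iff)
qed

lemma lookup_mult_keys:
  fixes f g :: "'a::comm_monoid_add \<Rightarrow>\<^sub>0 'b::comm_semiring_1"
  shows "Poly_Mapping.lookup (f * g) k =
    (\<Sum>p\<in>Poly_Mapping.keys f. \<Sum>q\<in>Poly_Mapping.keys g.
      if p + q = k then Poly_Mapping.lookup f p * Poly_Mapping.lookup g q else 0)"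
proof -
  have "f * g = (\<Sum>p\<in>Poly_Mapping.keys f. Poly_Mapping.single p (Poly_Mapping.lookup f p)) *
      (\<Sum>q\<in>Poly_Mapping.keys g. Poly_Mapping.single q (Poly_Mapping.lookup g q))"
    by (simp add: poly_mapping_sum_singles)
  also have "\<dots> = (\<Sum>p\<in>Poly_Mapping.keys f. \<Sum>q\<in>Poly_Mapping.keys g.
      Poly_Mapping.single (p + q) (Poly_Mapping.lookup f p * Poly_Mapping.lookup g q))"
    by (simp add: sum_product mult_single)
  finally show ?thesis
    by (simp add: lookup_sum lookup_single when_def)
qed

lemma monomial_add: "monomial (u + v) = (monomial u * monomial v :: ('e, 'k::field) edge_poly)"
  by (simp add: monomial_def mult_single)

lemma monomial_0: "monomial 0 = (1 :: ('e, 'k::field) edge_poly)"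
  by (simp add: monomial_def)

lemma monomial_sum:
  "(\<Prod>i\<in>I. monomial (u i)) = (monomial (\<Sum>i\<in>I. u i) :: ('e, 'k::field) edge_poly)"
  by (induction I rule: infinite_finite_induct) (auto simp: monomial_0 monomial_add)

lemma monomial_eq_iff: "(monomial u :: ('e, 'k::field) edge_poly) = monomial v \<longleftrightarrow> u = v"
  by (metis monomial_def keys_single singleton_inject zero_neq_one)

lemma keys_binomial:
  assumes "u \<noteq> v"
  shows "Poly_Mapping.keys (monomial u - monomial v :: ('e, 'k::field) edge_poly) = {u, v}"
  using assms by (auto simp: monomial_def in_keys_iff lookup_minus lookup_single when_def split: if_splits)

subsection \<open>Congruences on exponents and binomial ideals\<close>

text \<open>A linear functional. As \<open>C\<close> runs over the classes of a congruence, its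
  values are the coefficients of the image of \<open>p\<close> in the algebra of the quotient
  monoid.\<close>

definition class_coeff ::
  "(('e \<Rightarrow>\<^sub>0 nat) \<Rightarrow> bool) \<Rightarrow> ('e, 'k::field) edge_poly \<Rightarrow> 'k" where
  "class_coeff C p = (\<Sum>m\<in>Poly_Mapping.keys p. if C m then Poly_Mapping.lookup p m else 0)"

lemma class_coeff_0 [simp]: "class_coeff C 0 = 0"
  by (simp add: class_coeff_def)

lemma class_coeff_add: "class_coeff C (p + q) = class_coeff C p + class_coeff C q"
  unfolding class_coeff_def by (rule setsum_keys_plus_distrib) auto

lemma class_coeff_diff: "class_coeff C (p - q) = class_coeff C p - class_coeff C q"
  using class_coeff_add[of C "p - q" q] by simp

lemma class_coeff_sum: "class_coeff C (\<Sum>i\<in>I. p i) = (\<Sum>i\<in>I. class_coeff C (p i))"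
  by (induction I rule: infinite_finite_induct) (auto simp: class_coeff_add)

lemma class_coeff_single:
  "class_coeff C (Poly_Mapping.single m c) = (if C m then c else 0)"
  by (simp add: class_coeff_def)

lemma class_coeff_monomial: "class_coeff C (monomial m) = (if C m then 1 else 0)"
  by (simp add: monomial_def class_coeff_single)

text \<open>A monomial multiple of a generator still has both terms in one class, where their
  coefficients 1 and -1 cancel.\<close>

lemma class_coeff_ideal_gen:
  fixes R :: "('e \<Rightarrow>\<^sub>0 nat) \<Rightarrow> ('e \<Rightarrow>\<^sub>0 nat) \<Rightarrow> bool"
    and p :: "('e, 'k::field) edge_poly"
  assumes "equivp R" and shift: "\<And>u v w. R u v \<Longrightarrow> R (u + w) (v + w)"
    and "p \<in> ideal_gen S" and S: "S \<subseteq> {monomial a - monomial b |a b. R a b}"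
  shows "class_coeff (\<lambda>m. R m m0) p = 0"
  using assms(3) unfolding ideal_gen_def
proof (induction rule: module.span_induct_alt[OF module_ring_mult, consumes 1])
  case 1
  show ?case by simp
next
  case (2 c x y)
  then obtain a b where x: "x = monomial a - monomial b" and "R a b"
    using S by auto
  have R: "R (m + a) m0 \<longleftrightarrow> R (m + b) m0" for m
    using shift[OF \<open>R a b\<close>, of m] \<open>equivp R\<close>
    by (metis add.commute equivp_symp equivp_transp)
  have "c * x = (\<Sum>m\<in>Poly_Mapping.keys c. Poly_Mapping.single m (Poly_Mapping.lookup c m)) * x"
    by (simp add: poly_mapping_sum_singles)
  also have "\<dots> = (\<Sum>m\<in>Poly_Mapping.keys c.
      Poly_Mapping.single (m + a) (Poly_Mapping.lookup c m) -
      Poly_Mapping.single (m + b) (Poly_Mapping.lookup c m))"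
    by (simp add: x sum_distrib_right right_diff_distrib monomial_def mult_single sum_subtractf)
  finally have "class_coeff (\<lambda>m. R m m0) (c * x) = 0"
    by (simp add: class_coeff_sum class_coeff_diff class_coeff_single R)
  with 2 show ?case
    by (simp add: class_coeff_add)
qed

text \<open>The functional of the class of \<open>v\<close> is 0 on the ideal. On the binomial it is
  1 - 1 if \<open>R u v\<close> holds and 0 - 1 otherwise.\<close>

lemma binomial_in_ideal_gen_congruence:
  fixes R :: "('e \<Rightarrow>\<^sub>0 nat) \<Rightarrow> ('e \<Rightarrow>\<^sub>0 nat) \<Rightarrow> bool"
  assumes "equivp R" and "\<And>u v w. R u v \<Longrightarrow> R (u + w) (v + w)"
    and "(monomial u - monomial v :: ('e, 'k::field) edge_poly) \<in> ideal_gen S"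
    and "S \<subseteq> {monomial a - monomial b |a b. R a b}"
  shows "R u v"
proof -
  have "class_coeff (\<lambda>m. R m v) (monomial u - monomial v :: ('e, 'k) edge_poly) = 0"
    using class_coeff_ideal_gen[of R] assms by blast
  then show ?thesis
    using equivp_reflp[OF assms(1)] by (simp add: class_coeff_diff class_coeff_monomial split: if_splits)
qed

lemma ideal_gen_singleton: "ideal_gen {x} = {y. x dvd y}"
  by (auto simp: ideal_gen_def module.span_singleton[OF module_ring_mult] dvd_def mult.commute)

definition net :: "('e \<Rightarrow>\<^sub>0 nat) \<Rightarrow> ('e \<Rightarrow>\<^sub>0 nat) \<Rightarrow> 'e \<Rightarrow> int" where
  "net u v e = int (Poly_Mapping.lookup u e) - int (Poly_Mapping.lookup v e)"

lemma net_eq_0_iff: "net u v = (\<lambda>_. 0) \<longleftrightarrow> u = v"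
  by (auto simp: net_def poly_mapping_eq_iff fun_eq_iff)

text \<open>To differ by an integer multiple of \<open>net a b\<close> is a congruence on exponents,
  and it identifies \<open>a\<close> with \<open>b\<close>.\<close>

lemma binomial_dvd_imp_net_multiple:
  assumes "(monomial a - monomial b :: ('e, 'k::field) edge_poly) dvd monomial u - monomial v"
  obtains k where "\<And>e. net u v e = k * net a b e"
proof -
  define R where "R u v \<longleftrightarrow> (\<exists>k. \<forall>e. net u v e = k * net a b e)" for u v
  have "R u v"
  proof (rule binomial_in_ideal_gen_congruence)
    show "equivp R"
    proof (rule equivpI)
      show "reflp R" by (auto simp: R_def net_def intro!: reflpI exI[of _ 0])
      show "symp R"
      proof (rule sympI)
        fix u v assume "R u v"
        then obtain k where "\<forall>e. net u v e = k * net a b e" by (auto simp: R_def)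
        then have "\<forall>e. net v u e = (-k) * net a b e"
          by (auto simp: net_def algebra_simps)
        then show "R v u" unfolding R_def by blast
      qed
      show "transp R"
      proof (rule transpI)
        fix u v w assume "R u v" "R v w"
        then obtain k l where "\<forall>e. net u v e = k * net a b e" "\<forall>e. net v w e = l * net a b e"
          by (auto simp: R_def)
        moreover have "net u w e = net u v e + net v w e" for e by (simp add: net_def)
        ultimately have "\<forall>e. net u w e = (k + l) * net a b e"
          by (simp add: distrib_right)
        then show "R u w" unfolding R_def by blast
      qed
    qed
    show "R (u + w) (v + w)" if "R u v" for u v w
      using that by (simp add: R_def net_def lookup_add)
    show "(monomial u - monomial v :: ('e, 'k) edge_poly) \<in> ideal_gen {monomial a - monomial b}"
      using assms by (simp add: ideal_gen_singleton)
    have "R a b" by (auto simp: R_def intro: exI[of _ 1])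
    then show "{monomial a - monomial b :: ('e, 'k) edge_poly} \<subseteq>
        {monomial a - monomial b |a b. R a b}" by auto
  qed
  then show ?thesis using that by (auto simp: R_def)
qed

text \<open>For a multiple \<open>n\<close> that is not negative, coprimality allows
  \<open>n\<close> copies of \<open>a\<close> to be split off from \<open>u\<close> and
  \<open>n\<close> copies of \<open>b\<close> from \<open>v\<close>, with the same remainder. What
  is left is a difference of two n-th powers. A negative multiple is treated by swapping
  \<open>u\<close> and \<open>v\<close>.\<close>

lemma net_multiple_imp_binomial_dvd:
  assumes coprime: "\<And>e. Poly_Mapping.lookup a e = 0 \<or> Poly_Mapping.lookup b e = 0"
    and mult: "\<And>e. net u v e = k * net a b e"
  shows "(monomial a - monomial b :: ('e, 'k::field) edge_poly) dvd monomial u - monomial v"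
proof -
  have pos: "(monomial a - monomial b :: ('e, 'k::field) edge_poly) dvd monomial u - monomial v"
    if uv: "\<And>e. net u v e = int n * net a b e" for u v n
  proof -
    define A where "A = (\<Sum>i<n. a)"
    define B where "B = (\<Sum>i<n. b)"
    have AB: "Poly_Mapping.lookup A e = n * Poly_Mapping.lookup a e"
      "Poly_Mapping.lookup B e = n * Poly_Mapping.lookup b e" for e
      by (auto simp: A_def B_def lookup_sum)
    have eq: "int (Poly_Mapping.lookup u e) + int n * int (Poly_Mapping.lookup b e) =
        int (Poly_Mapping.lookup v e) + int n * int (Poly_Mapping.lookup a e)" for e
      using uv[of e] by (simp add: net_def algebra_simps)
    have eqn: "Poly_Mapping.lookup u e + n * Poly_Mapping.lookup b e =
        Poly_Mapping.lookup v e + n * Poly_Mapping.lookup a e" for e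
      using eq[of e] by (metis of_nat_add of_nat_eq_iff of_nat_mult)
    \<comment> \<open>Subtraction of exponents is truncated, but nothing is cut off: where
      \<open>a\<close> is positive, \<open>b\<close> vanishes and \<open>u\<close> exceeds
      \<open>v\<close> by \<open>n\<close> times \<open>a\<close>.\<close>
    define m where "m = u - A"
    have "u = m + A"
    proof (rule poly_mapping_eqI)
      fix e show "Poly_Mapping.lookup u e = Poly_Mapping.lookup (m + A) e"
        using eqn[of e] coprime[of e] by (auto simp: m_def lookup_add lookup_minus AB)
    qed
    moreover have "v = m + B"
    proof (rule poly_mapping_eqI)
      fix e show "Poly_Mapping.lookup v e = Poly_Mapping.lookup (m + B) e"
        using eqn[of e] coprime[of e] by (auto simp: m_def lookup_add lookup_minus AB)
    qed
    ultimately have "monomial u - monomial v =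
        monomial m * (monomial a ^ n - monomial b ^ n :: ('e, 'k::field) edge_poly)"
      by (simp add: monomial_add A_def B_def flip: monomial_sum) (simp add: algebra_simps)
    moreover have "monomial a - monomial b dvd (monomial a ^ n - monomial b ^ n :: ('e, 'k::field) edge_poly)"
      by (metis dvd_triv_left power_diff_sumr2)
    ultimately show ?thesis by simp
  qed
  show ?thesis
  proof (cases "k \<ge> 0")
    case True
    then show ?thesis using pos[of u v "nat k"] mult by simp
  next
    case False
    have "net v u e = int (nat (-k)) * net a b e" for e
      using mult[of e] False by (simp add: net_def algebra_simps)
    from pos[OF this] show ?thesis by (metis dvd_minus_iff minus_diff_eq)
  qed
qed

text \<open>The monomials divisible by \<open>e\<close> form one class of this congruence, all
  others are singletons. It captures a common factor of the two monomials, which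
  \<open>net a b\<close> does not record.\<close>

lemma binomial_dvd_common_variable:
  assumes dvd: "(monomial a - monomial b :: ('e, 'k::field) edge_poly) dvd monomial u - monomial v"
    and e: "Poly_Mapping.lookup a e > 0" "Poly_Mapping.lookup b e > 0"
  shows "u = v \<or> Poly_Mapping.lookup u e > 0 \<and> Poly_Mapping.lookup v e > 0"
proof (rule binomial_in_ideal_gen_congruence[where
      R = "\<lambda>u v. u = v \<or> Poly_Mapping.lookup u e > 0 \<and> Poly_Mapping.lookup v e > 0"])
  show "equivp (\<lambda>u v. u = v \<or> Poly_Mapping.lookup u e > 0 \<and> Poly_Mapping.lookup v e > 0)"
    by (intro equivpI reflpI sympI transpI) auto
  show "(monomial u - monomial v :: ('e, 'k) edge_poly) \<in> ideal_gen {monomial a - monomial b}"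
    using dvd by (simp add: ideal_gen_singleton)
qed (use e in \<open>auto simp: lookup_add\<close>)

subsection \<open>Irreducible binomials\<close>

text \<open>Setting all variables to 1 is the functional of the congruence with a single class. It
  kills the ideal of the binomial, but not 1.\<close>

lemma binomial_not_unit: "\<not> (monomial a - monomial b :: ('e, 'k::field) edge_poly) dvd 1"
proof
  assume "(monomial a - monomial b :: ('e, 'k) edge_poly) dvd 1"
  then have "(1 :: ('e, 'k) edge_poly) \<in> ideal_gen {monomial a - monomial b}"
    by (simp add: ideal_gen_singleton)
  from class_coeff_ideal_gen[of "\<lambda>_ _. True", OF _ _ this]
  have "class_coeff (\<lambda>_. True) (1 :: ('e, 'k) edge_poly) = 0"
    by (auto simp: equivp_def)
  then show False by (simp add: class_coeff_monomial flip: monomial_0)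
qed

text \<open>Lexicographically largest elements have this property. One coordinate at a time, both
  sets are cut down to the elements where it is maximal. The invariant is that a sum of two
  remaining elements cannot be written with any discarded one.\<close>

lemma ex_unique_sum:
  fixes A B :: "('e::finite \<Rightarrow>\<^sub>0 nat) set"
  assumes "finite A" "finite B" "A \<noteq> {}" "B \<noteq> {}"
  obtains p q where "p \<in> A" "q \<in> B"
    "\<And>p' q'. p' \<in> A \<Longrightarrow> q' \<in> B \<Longrightarrow> p' + q' = p + q \<Longrightarrow> p' = p \<and> q' = q"
proof -
  let ?l = "Poly_Mapping.lookup"
  have "\<exists>A'\<subseteq>A. \<exists>B'\<subseteq>B. A' \<noteq> {} \<and> B' \<noteq> {} \<and>
     (\<forall>e\<in>S. (\<forall>p\<in>A'. \<forall>p'\<in>A'. ?l p e = ?l p' e) \<and> (\<forall>p\<in>B'. \<forall>p'\<in>B'. ?l p e = ?l p' e)) \<and>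
     (\<forall>p\<in>A'. \<forall>q\<in>B'. \<forall>p'\<in>A. \<forall>q'\<in>B. p' + q' = p + q \<longrightarrow> p' \<in> A' \<and> q' \<in> B')" for S :: "'e set"
  proof (induction S rule: finite_induct[OF finite])
    case 1
    show ?case using assms by (intro exI[of _ A] exI[of _ B] conjI) auto
  next
    case (2 e S)
    then obtain A' B' where A': "A' \<subseteq> A" "B' \<subseteq> B" "A' \<noteq> {}" "B' \<noteq> {}"
      and const: "\<forall>e\<in>S. (\<forall>p\<in>A'. \<forall>p'\<in>A'. ?l p e = ?l p' e) \<and> (\<forall>p\<in>B'. \<forall>p'\<in>B'. ?l p e = ?l p' e)"
      and face: "\<forall>p\<in>A'. \<forall>q\<in>B'. \<forall>p'\<in>A. \<forall>q'\<in>B. p' + q' = p + q \<longrightarrow> p' \<in> A' \<and> q' \<in> B'"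
      by (elim exE conjE) (rule that)
    have fin: "finite A'" "finite B'" using A' assms finite_subset by blast+
    define A'' where "A'' = {p\<in>A'. ?l p e = Max ((\<lambda>p. ?l p e) ` A')}"
    define B'' where "B'' = {p\<in>B'. ?l p e = Max ((\<lambda>p. ?l p e) ` B')}"
    have "Max ((\<lambda>p. ?l p e) ` A') \<in> (\<lambda>p. ?l p e) ` A'" "Max ((\<lambda>p. ?l p e) ` B') \<in> (\<lambda>p. ?l p e) ` B'"
      using fin A' by (auto intro!: Max_in)
    then have ne: "A'' \<noteq> {}" "B'' \<noteq> {}" by (auto simp: A''_def B''_def)
    have max: "?l p e \<le> Max ((\<lambda>p. ?l p e) ` A')" if "p \<in> A'" for p using that fin by simp
    have max': "?l p e \<le> Max ((\<lambda>p. ?l p e) ` B')" if "p \<in> B'" for p using that fin by simp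
    have "p' \<in> A'' \<and> q' \<in> B''"
      if "p \<in> A''" "q \<in> B''" "p' \<in> A" "q' \<in> B" and eq: "p' + q' = p + q" for p q p' q'
    proof -
      have "p' \<in> A'" "q' \<in> B'" using that face unfolding A''_def B''_def by blast+
      moreover have "?l p' e + ?l q' e = ?l p e + ?l q e"
        using arg_cong[OF eq, of "\<lambda>m. ?l m e"] by (simp add: lookup_add)
      ultimately show ?thesis using that max[of p'] max'[of q']
        by (simp add: A''_def B''_def)
    qed
    then have face': "\<forall>p\<in>A''. \<forall>q\<in>B''. \<forall>p'\<in>A. \<forall>q'\<in>B. p' + q' = p + q \<longrightarrow> p' \<in> A'' \<and> q' \<in> B''"
      by blast
    have sub: "A'' \<subseteq> A'" "B'' \<subseteq> B'" by (auto simp: A''_def B''_def)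
    have const': "(\<forall>p\<in>A''. \<forall>p'\<in>A''. ?l p e' = ?l p' e') \<and> (\<forall>p\<in>B''. \<forall>p'\<in>B''. ?l p e' = ?l p' e')"
      if "e' \<in> insert e S" for e'
    proof (cases "e' = e")
      case True
      then show ?thesis by (simp add: A''_def B''_def)
    next
      case False
      then show ?thesis using that const sub by blast
    qed
    have AB: "A'' \<subseteq> A" "B'' \<subseteq> B" using sub A' by blast+
    show ?case
      by (rule exI[of _ A''], rule conjI, rule AB, rule exI[of _ B''])
        (intro conjI AB ne face' ballI[OF const'])
  qed
  from this[of UNIV] obtain A' B' where A': "A' \<subseteq> A" "B' \<subseteq> B" "A' \<noteq> {}" "B' \<noteq> {}"
    and const: "\<forall>e\<in>UNIV. (\<forall>p\<in>A'. \<forall>p'\<in>A'. ?l p e = ?l p' e) \<and> (\<forall>p\<in>B'. \<forall>p'\<in>B'. ?l p e = ?l p' e)"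
    and face: "\<forall>p\<in>A'. \<forall>q\<in>B'. \<forall>p'\<in>A. \<forall>q'\<in>B. p' + q' = p + q \<longrightarrow> p' \<in> A' \<and> q' \<in> B'"
    by (elim exE conjE) (rule that)
  obtain p q where pq: "p \<in> A'" "q \<in> B'" using A' by auto
  show ?thesis
  proof (rule that)
    show "p \<in> A" "q \<in> B" using pq A' by auto
    fix p' q' assume "p' \<in> A" "q' \<in> B" "p' + q' = p + q"
    then have "p' \<in> A'" "q' \<in> B'" using face pq by blast+
    then have "?l p' e = ?l p e" "?l q' e = ?l q e" for e using const pq by blast+
    then show "p' = p \<and> q' = q" by (auto intro: poly_mapping_eqI)
  qed
qed

text \<open>Several exponents may tie for the largest value of \<open>l\<close>. Among these a pair
  with a unique sum is chosen, so that its product of coefficients cannot be cancelled.\<close>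

lemma keys_mult_top:
  fixes f g :: "('e::finite, 'k::field) edge_poly" and l :: "('e \<Rightarrow>\<^sub>0 nat) \<Rightarrow> int"
  assumes add: "\<And>p q. l (p + q) = l p + l q"
    and P: "P \<in> Poly_Mapping.keys f" "\<And>p. p \<in> Poly_Mapping.keys f \<Longrightarrow> l p \<le> l P"
    and Q: "Q \<in> Poly_Mapping.keys g" "\<And>q. q \<in> Poly_Mapping.keys g \<Longrightarrow> l q \<le> l Q"
  shows "\<exists>m\<in>Poly_Mapping.keys (f * g). l m = l P + l Q"
proof -
  define A where "A = {p\<in>Poly_Mapping.keys f. l p = l P}"
  define B where "B = {q\<in>Poly_Mapping.keys g. l q = l Q}"
  have "finite A" "finite B" "A \<noteq> {}" "B \<noteq> {}" using P Q by (auto simp: A_def B_def)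
  from ex_unique_sum[OF this] obtain p q where pq: "p \<in> A" "q \<in> B"
    and uniq: "\<And>p' q'. p' \<in> A \<Longrightarrow> q' \<in> B \<Longrightarrow> p' + q' = p + q \<Longrightarrow> p' = p \<and> q' = q" by blast
  have uniq': "p' + q' = p + q \<longleftrightarrow> p' = p \<and> q' = q"
    if "p' \<in> Poly_Mapping.keys f" "q' \<in> Poly_Mapping.keys g" for p' q'
  proof
    assume eq: "p' + q' = p + q"
    then have "l p' + l q' = l P + l Q" using pq add[of p' q'] add[of p q] by (simp add: A_def B_def)
    then have "p' \<in> A" "q' \<in> B" using that P(2)[of p'] Q(2)[of q'] by (auto simp: A_def B_def)
    then show "p' = p \<and> q' = q" using uniq eq by blast
  qed auto
  have "Poly_Mapping.lookup (f * g) (p + q) =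
    (\<Sum>p'\<in>Poly_Mapping.keys f. \<Sum>q'\<in>Poly_Mapping.keys g. if p' = p then if q' = q
      then Poly_Mapping.lookup f p * Poly_Mapping.lookup g q else 0 else 0)"
    unfolding lookup_mult_keys by (intro sum.cong refl) (auto simp: uniq')
  also have "\<dots> = Poly_Mapping.lookup f p * Poly_Mapping.lookup g q"
    using pq by (simp add: A_def B_def sum.If_cases flip: sum_distrib_left cong: if_cong)
  also have "\<dots> \<noteq> 0" using pq by (auto simp: A_def B_def in_keys_iff)
  finally have "p + q \<in> Poly_Mapping.keys (f * g)" by (simp add: in_keys_iff)
  moreover have "l (p + q) = l P + l Q" using pq by (simp add: A_def B_def add)
  ultimately show ?thesis by blast
qed

text \<open>The previous lemma for \<open>l\<close> and for \<open>- l\<close>: the extreme values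
  on the two factors add up to extreme values on the product, whose only exponents are
  \<open>a\<close> and \<open>b\<close>.\<close>

lemma mult_eq_binomial_extremes:
  fixes f g :: "('e::finite, 'k::field) edge_poly" and l :: "('e \<Rightarrow>\<^sub>0 nat) \<Rightarrow> int"
  assumes fg: "f * g = monomial a - monomial b" and "a \<noteq> b"
    and add: "\<And>p q. l (p + q) = l p + l q"
  obtains P P' Q Q' where
    "P \<in> Poly_Mapping.keys f" "P' \<in> Poly_Mapping.keys f"
    "\<And>p. p \<in> Poly_Mapping.keys f \<Longrightarrow> l P' \<le> l p \<and> l p \<le> l P"
    "Q \<in> Poly_Mapping.keys g" "Q' \<in> Poly_Mapping.keys g"
    "\<And>q. q \<in> Poly_Mapping.keys g \<Longrightarrow> l Q' \<le> l q \<and> l q \<le> l Q"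
    "l P + l Q \<in> {l a, l b}" "l P' + l Q' \<in> {l a, l b}"
proof -
  have "f * g \<noteq> 0" using \<open>a \<noteq> b\<close> by (simp add: fg monomial_eq_iff)
  then have "f \<noteq> 0" "g \<noteq> 0" by auto
  then have ne: "Poly_Mapping.keys f \<noteq> {}" "Poly_Mapping.keys g \<noteq> {}" by auto
  have ex_max: "\<exists>P\<in>K. \<forall>p\<in>K. h p \<le> h P" if "finite K" "K \<noteq> {}"
    for K :: "('e \<Rightarrow>\<^sub>0 nat) set" and h :: "_ \<Rightarrow> int"
  proof -
    have "Max (h ` K) \<in> h ` K" using that by simp
    then obtain P where "P \<in> K" "h P = Max (h ` K)" by auto
    then show ?thesis using that by (auto intro!: bexI[of _ P])
  qed
  obtain P Q where P: "P \<in> Poly_Mapping.keys f" "\<forall>p\<in>Poly_Mapping.keys f. l p \<le> l P"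
    and Q: "Q \<in> Poly_Mapping.keys g" "\<forall>p\<in>Poly_Mapping.keys g. l p \<le> l Q"
    using ex_max[of "Poly_Mapping.keys f" l] ex_max[of "Poly_Mapping.keys g" l] ne by auto
  obtain P' Q' where P': "P' \<in> Poly_Mapping.keys f" "\<forall>p\<in>Poly_Mapping.keys f. - l p \<le> - l P'"
    and Q': "Q' \<in> Poly_Mapping.keys g" "\<forall>p\<in>Poly_Mapping.keys g. - l p \<le> - l Q'"
    using ex_max[of "Poly_Mapping.keys f" "\<lambda>p. - l p"]
      ex_max[of "Poly_Mapping.keys g" "\<lambda>p. - l p"] ne by auto
  have "\<exists>m\<in>{a, b}. l m = l P + l Q"
    using keys_mult_top[of l P f Q g] P Q add \<open>a \<noteq> b\<close> by (auto simp: fg keys_binomial)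
  moreover have "\<exists>m\<in>{a, b}. - l m = - l P' + - l Q'"
    using keys_mult_top[of "\<lambda>p. - l p" P' f Q' g] P' Q' add \<open>a \<noteq> b\<close>
    by (auto simp: fg keys_binomial)
  ultimately show ?thesis
    using that[of P P' Q Q'] P Q P' Q' by force
qed

text \<open>If \<open>x e0\<close> is nonzero, it divides every \<open>y e0 * x e\<close>, hence
  \<open>y e0\<close> times the gcd of all values of \<open>x\<close>, and this gcd is a
  unit.\<close>

lemma proportional_to_primitive:
  fixes x y :: "'a \<Rightarrow> int"
  assumes prim: "\<And>d. (\<And>e. d dvd x e) \<Longrightarrow> d dvd 1"
    and propor: "\<And>e e'. x e * y e' = x e' * y e"
  obtains k where "\<And>e. y e = k * x e"
proof -
  have G: "Gcd (range x) dvd 1" by (rule prim) auto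
  obtain e0 where e0: "x e0 \<noteq> 0" using prim[of 0] by auto
  have "x e0 dvd Gcd ((*) (y e0) ` range x)"
    using propor[of e0] by (intro Gcd_greatest) (auto simp: mult.commute, metis dvd_triv_left)
  then have "x e0 dvd y e0" using G by (simp add: Gcd_mult)
  then obtain k where k: "y e0 = x e0 * k" by (elim dvdE)
  have "y e = k * x e" for e using propor[of e0 e] e0 by (simp add: k)
  then show ?thesis using that by blast
qed

text \<open>Two exponents of one factor differ by an integer multiple of \<open>net a b\<close>. In
  a coordinate \<open>e0\<close> where \<open>a\<close> is positive and \<open>b\<close> vanishes,
  the widths of the two factors therefore are multiples of the entry of \<open>a\<close>, and there
  is room for only one such multiple. So one factor is a single term, and coprimality makes it
  constant.\<close>

lemma irreducible_binomialI:
  fixes a b :: "'e::finite \<Rightarrow>\<^sub>0 nat"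
  assumes "a \<noteq> 0"
    and coprime: "\<And>e. Poly_Mapping.lookup a e = 0 \<or> Poly_Mapping.lookup b e = 0"
    and prim: "\<And>d. (\<And>e. d dvd net a b e) \<Longrightarrow> d dvd 1"
  shows "irreducible (monomial a - monomial b :: ('e, 'k::field) edge_poly)"
proof -
  let ?l = "Poly_Mapping.lookup"
  obtain e0 where e0: "?l a e0 \<noteq> 0" using \<open>a \<noteq> 0\<close> by (metis lookup_zero poly_mapping_eqI)
  then have b0: "?l b e0 = 0" using coprime[of e0] by auto
  have "a \<noteq> b" using e0 b0 by auto
  have line: "\<exists>k. \<forall>e. net p p' e = k * net a b e"
    if fg: "f * g = monomial a - monomial b" and p: "p \<in> Poly_Mapping.keys f" "p' \<in> Poly_Mapping.keys f"
    for f g :: "('e, 'k) edge_poly" and p p'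
  proof -
    have "net a b e * net p p' e' = net a b e' * net p p' e" for e e'
    proof -
      \<comment> \<open>This form takes the same value at \<open>a\<close> and \<open>b\<close>, so
        the product has width 0 in its direction, and then so has each factor.\<close>
      define l where "l m = net a b e * int (?l m e') - net a b e' * int (?l m e)" for m
      have "l a = l b" by (simp add: l_def net_def algebra_simps)
      moreover have "l (p + q) = l p + l q" for p q by (simp add: l_def lookup_add algebra_simps)
      ultimately have "l p = l p'" 
        using mult_eq_binomial_extremes[OF fg \<open>a \<noteq> b\<close>, of l] p
        by (smt (verit, best) insert_iff singletonD)
      then show ?thesis by (simp add: l_def net_def algebra_simps)
    qed
    then show ?thesis using proportional_to_primitive[OF prim] by metis
  qed
  have unit: "f dvd 1" if fg: "f * g = monomial a - monomial b"
    and P: "P \<in> Poly_Mapping.keys f"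
    and const: "\<And>p. p \<in> Poly_Mapping.keys f \<Longrightarrow> ?l p e0 = ?l P e0"
    for f g :: "('e, 'k) edge_poly" and P
  proof -
    have "p = P" if p: "p \<in> Poly_Mapping.keys f" for p
    proof -
      obtain k where k: "\<forall>e. net p P e = k * net a b e" using line[OF fg p P] by auto
      have "k * net a b e0 = 0" using k const[OF p] by (metis net_def diff_self)
      then have "k = 0" using e0 b0 by (simp add: net_def)
      then have "net p P = (\<lambda>_. 0)" using k by (simp add: fun_eq_iff)
      then show ?thesis by (simp add: net_eq_0_iff)
    qed
    then have keys: "Poly_Mapping.keys f = {P}" using P by blast
    \<comment> \<open>All exponents of the product are at least \<open>P\<close>, so
      \<open>P\<close> divides both \<open>a\<close> and \<open>b\<close>, which are
      coprime.\<close>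
    have "?l P e = 0" for e
    proof -
      have "?l P e \<le> ?l m e" if "m \<in> {a, b}" for m
        using that keys_mult[of f g] \<open>a \<noteq> b\<close> unfolding fg keys_binomial[OF \<open>a \<noteq> b\<close>] keys
        by (auto simp: lookup_add)
      from this[of a] this[of b] show ?thesis using coprime[of e] by auto
    qed
    then have "P = 0" by (auto intro: poly_mapping_eqI)
    then have f: "f = Poly_Mapping.single 0 (?l f 0)"
      using poly_mapping_sum_singles[of f] by (simp add: keys)
    moreover have "?l f 0 \<noteq> 0" using P \<open>P = 0\<close> by (simp add: in_keys_iff)
    ultimately have "f * Poly_Mapping.single 0 (1 / ?l f 0) = 1"
      by (metis mult_single add_0 single_one nonzero_divide_eq_eq mult.commute)
    then show ?thesis by (metis dvd_triv_left)
  qed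
  show ?thesis
  proof (rule irreducibleI)
    show "monomial a - monomial b \<noteq> (0 :: ('e, 'k) edge_poly)"
      using \<open>a \<noteq> b\<close> by (simp add: monomial_eq_iff)
    show "\<not> (monomial a - monomial b :: ('e, 'k) edge_poly) dvd 1"
      by (rule binomial_not_unit)
  next
    fix f g :: "('e, 'k) edge_poly"
    assume "monomial a - monomial b = f * g"
    then have fg: "f * g = monomial a - monomial b" and gf: "g * f = monomial a - monomial b"
      by (simp_all add: mult.commute)
    obtain P P' Q Q' where P: "P \<in> Poly_Mapping.keys f" "P' \<in> Poly_Mapping.keys f"
      "\<And>p. p \<in> Poly_Mapping.keys f \<Longrightarrow> int (?l P' e0) \<le> int (?l p e0) \<and> int (?l p e0) \<le> int (?l P e0)"
    and Q: "Q \<in> Poly_Mapping.keys g" "Q' \<in> Poly_Mapping.keys g"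
      "\<And>q. q \<in> Poly_Mapping.keys g \<Longrightarrow> int (?l Q' e0) \<le> int (?l q e0) \<and> int (?l q e0) \<le> int (?l Q e0)"
    and ext: "int (?l P e0) + int (?l Q e0) \<in> {int (?l a e0), int (?l b e0)}"
       "int (?l P' e0) + int (?l Q' e0) \<in> {int (?l a e0), int (?l b e0)}"
      by (rule mult_eq_binomial_extremes[OF fg \<open>a \<noteq> b\<close>, of "\<lambda>m. int (?l m e0)"])
        (auto simp: lookup_add)
    obtain k where "net P P' e0 = k * net a b e0" using line[OF fg P(1,2)] by auto
    moreover obtain j where "net Q Q' e0 = j * net a b e0" using line[OF gf Q(1,2)] by auto
    ultimately have kj: "int (?l P e0) - int (?l P' e0) = k * int (?l a e0)"
        "int (?l Q e0) - int (?l Q' e0) = j * int (?l a e0)"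
      by (simp_all add: net_def b0)
    have "k * int (?l a e0) \<ge> 0" "j * int (?l a e0) \<ge> 0"
      using P(3)[OF P(1)] Q(3)[OF Q(1)] by (simp_all flip: kj)
    then have nonneg: "k \<ge> 0" "j \<ge> 0" using e0 by (auto simp: zero_le_mult_iff)
    \<comment> \<open>The left side is the sum of the two widths, a difference of two numbers each
      of which is \<open>?l a e0\<close> or 0.\<close>
    have "(k + j) * int (?l a e0) \<le> 1 * int (?l a e0)"
      using ext by (auto simp: distrib_right b0 simp flip: kj)
    then have "k + j \<le> 1" using e0 by (subst (asm) mult_le_cancel_right) auto
    with nonneg have "k = 0 \<or> j = 0" by linarith
    then show "f dvd 1 \<or> g dvd 1"
    proof
      assume "k = 0"
      then have "?l p e0 = ?l P e0" if "p \<in> Poly_Mapping.keys f" for p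
        using P(3)[OF that] kj by simp
      then show ?thesis using unit[OF fg P(1)] by blast
    next
      assume "j = 0"
      then have "?l q e0 = ?l Q e0" if "q \<in> Poly_Mapping.keys g" for q
        using Q(3)[OF that] kj by simp
      then show ?thesis using unit[OF gf Q(1)] by blast
    qed
  qed
qed

text \<open>Exponents are natural numbers, so only two zero exponents add up to zero. A vanishing
  constant term thus certifies a non-unit.\<close>

lemma lookup_mult_zero:
  fixes f g :: "('e, 'k::field) edge_poly"
  shows "Poly_Mapping.lookup (f * g) 0 = Poly_Mapping.lookup f 0 * Poly_Mapping.lookup g 0"
proof -
  have "p + q = 0 \<longleftrightarrow> p = 0 \<and> q = 0" for p q :: "'e \<Rightarrow>\<^sub>0 nat"
    by (auto simp: poly_mapping_eq_iff fun_eq_iff lookup_add)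
  then have "Poly_Mapping.lookup (f * g) 0 =
    (\<Sum>p\<in>Poly_Mapping.keys f. \<Sum>q\<in>Poly_Mapping.keys g. if p = 0 then if q = 0
      then Poly_Mapping.lookup f 0 * Poly_Mapping.lookup g 0 else 0 else 0)"
    unfolding lookup_mult_keys by (intro sum.cong refl) auto
  also have "\<dots> = (\<Sum>p\<in>Poly_Mapping.keys f. if p = 0 then
     (\<Sum>q\<in>Poly_Mapping.keys g. if q = 0 then Poly_Mapping.lookup f 0 * Poly_Mapping.lookup g 0 else 0) else 0)"
    by (intro sum.cong) auto
  also have "\<dots> = Poly_Mapping.lookup f 0 * Poly_Mapping.lookup g 0"
    by (simp add: in_keys_iff)
  finally show ?thesis .
qed

lemma not_unit_if_lookup_zero:
  fixes f :: "('e, 'k::field) edge_poly"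
  assumes "Poly_Mapping.lookup f 0 = 0"
  shows "\<not> f dvd 1"
  using assms by (metis dvdE lookup_mult_zero lookup_one_zero mult_zero_left zero_neq_one)

text \<open>A common variable could be split off, and neither it nor the remaining binomial is a
  unit.\<close>

lemma irreducible_binomial_coprime:
  assumes irr: "irreducible (monomial a - monomial b :: ('e, 'k::field) edge_poly)"
  shows "Poly_Mapping.lookup a e = 0 \<or> Poly_Mapping.lookup b e = 0"
proof (rule ccontr)
  assume *: "\<not> ?thesis"
  define s where "s = Poly_Mapping.single e (1 :: nat)"
  have "c = s + (c - s)" if "Poly_Mapping.lookup c e \<noteq> 0" for c
    using that by (intro poly_mapping_eqI) (auto simp: s_def lookup_add lookup_minus lookup_single when_def)
  with * have "a = s + (a - s)" "b = s + (b - s)" by blast+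
  then have "(monomial a - monomial b :: ('e, 'k) edge_poly) =
      monomial s * (monomial (a - s) - monomial (b - s))"
    by (metis monomial_add right_diff_distrib)
  then have "monomial s dvd (1 :: ('e, 'k) edge_poly)"
    using irreducibleD[OF irr] binomial_not_unit by blast
  moreover have "\<not> monomial s dvd (1 :: ('e, 'k) edge_poly)"
    by (rule not_unit_if_lookup_zero) (auto simp: monomial_def s_def lookup_single when_def
      poly_mapping_eq_iff fun_eq_iff)
  ultimately show False by blast
qed

text \<open>By coprimality a common divisor \<open>n\<close> of the differences divides
  \<open>a\<close> and \<open>b\<close> separately. The binomial is then a difference of n-th powers
  and has the difference of the bases as a proper factor.\<close>

lemma irreducible_binomial_primitive:
  assumes irr: "irreducible (monomial a - monomial b :: ('e, 'k::field) edge_poly)"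
    and "a \<noteq> 0" "b \<noteq> 0" and d: "\<And>e. d dvd net a b e"
  shows "d dvd 1"
proof (rule ccontr)
  assume "\<not> d dvd 1"
  define n where "n = nat \<bar>d\<bar>"
  have n1: "n \<noteq> 1" using \<open>\<not> d dvd 1\<close> by (auto simp: n_def)
  let ?l = "Poly_Mapping.lookup"
  note coprime = irreducible_binomial_coprime[OF irr]
  have dvd: "n dvd ?l a e" "n dvd ?l b e" for e
  proof -
    have "int n dvd net a b e" using d by (simp add: n_def)
    then show "n dvd ?l a e" "n dvd ?l b e" using coprime[of e] by (auto simp: net_def)
  qed
  have div: "\<exists>c'. c = (\<Sum>i<n. c')" if "\<And>e. n dvd ?l c e" for c :: "'a \<Rightarrow>\<^sub>0 nat"
  proof
    define c' where "c' = Poly_Mapping.map (\<lambda>k. k div n) c"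
    have "?l c' e = ?l c e div n" for e
      by (simp add: c'_def Poly_Mapping.map.rep_eq when_def)
    then show "c = (\<Sum>i<n. c')" using that
      by (intro poly_mapping_eqI) (auto simp: lookup_sum)
  qed
  obtain a' b' where a': "a = (\<Sum>i<n. a')" and b': "b = (\<Sum>i<n. b')"
    using div[of a] div[of b] dvd by auto
  have "n \<noteq> 0" using \<open>a \<noteq> 0\<close> a' by (cases n) auto
  have ab': "a' \<noteq> 0" "b' \<noteq> 0" using a' b' \<open>a \<noteq> 0\<close> \<open>b \<noteq> 0\<close> by auto
  define Q where "Q = (\<Sum>i<n. monomial b' ^ (n - Suc i) * (monomial a' ^ i) :: ('e, 'k) edge_poly)"
  have "monomial a - monomial b = monomial a' ^ n - (monomial b' ^ n :: ('e, 'k) edge_poly)"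
    by (simp add: a' b' flip: monomial_sum)
  also have "\<dots> = (monomial a' - monomial b') * Q"
    unfolding Q_def by (rule power_diff_sumr2)
  finally have "Q dvd 1" using irreducibleD[OF irr] binomial_not_unit by blast
  \<comment> \<open>The two powers in each summand have total degree \<open>n - 1\<close>, which is
    positive, so one of the nonconstant monomials occurs.\<close>
  moreover have "?l Q 0 = 0"
  proof -
    have pow: "?l (f ^ i) 0 = ?l f 0 ^ i" for f :: "('e, 'k) edge_poly" and i
      by (induction i) (auto simp: lookup_mult_zero)
    have "?l (monomial c :: ('e, 'k) edge_poly) 0 = 0" if "c \<noteq> 0" for c
      using that by (simp add: monomial_def lookup_single when_def)
    then have "?l (monomial b' ^ (n - Suc i) * (monomial a' ^ i) :: ('e, 'k) edge_poly) 0 = 0" if "i < n" for i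
      using ab' that n1 \<open>n \<noteq> 0\<close> by (auto simp: lookup_mult_zero pow power_0_left)
    then show ?thesis by (simp add: Q_def lookup_sum)
  qed
  ultimately show False using not_unit_if_lookup_zero by blast
qed

subsection \<open>Balanced edge weights and the toric ideal\<close>

text \<open>The integer kernel of the unsigned vertex-edge incidence matrix of the graph.\<close>

definition balanced :: "('e::finite \<Rightarrow> 'v::finite set) \<Rightarrow> ('e \<Rightarrow> int) \<Rightarrow> bool" where
  "balanced ends y \<longleftrightarrow> (\<forall>v. (\<Sum>e | v \<in> ends e. y e) = 0)"

lemma lookup_edge_vec: "Poly_Mapping.lookup (edge_vec ends e) v = (if v \<in> ends e then 1 else 0)"
proof -
  have "Poly_Mapping.lookup (edge_vec ends e) v = (\<Sum>w\<in>ends e. if w = v then 1 else 0)"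
    by (simp add: edge_vec_def lookup_sum)
  then show ?thesis by simp
qed

lemma lookup_graph_degree:
  "Poly_Mapping.lookup (graph_degree ends u) v =
    (\<Sum>e | v \<in> ends e. int (Poly_Mapping.lookup u e))"
  by (simp add: graph_degree_def lookup_sum lookup_edge_vec sum.If_cases if_distrib cong: if_cong)

lemma graph_degree_eq_iff: "graph_degree ends u = graph_degree ends v \<longleftrightarrow> balanced ends (net u v)"
  by (simp add: poly_mapping_eq_iff fun_eq_iff lookup_graph_degree balanced_def net_def sum_subtractf)

lemma graph_degree_add: "graph_degree ends (u + v) = graph_degree ends u + graph_degree ends v"
  by (rule poly_mapping_eqI) (simp add: lookup_graph_degree lookup_add sum.distrib)

text \<open>Having the same degree is a congruence that identifies the terms of every generator;
  conversely, such a binomial is itself a generator.\<close>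

lemma binomial_in_toric_ideal_iff:
  "(monomial u - monomial v :: ('e::finite, 'k::field) edge_poly) \<in> toric_ideal ends \<longleftrightarrow>
    balanced ends (net u v)"
proof
  assume *: "(monomial u - monomial v :: ('e, 'k) edge_poly) \<in> toric_ideal ends"
  have "graph_degree ends u = graph_degree ends v"
    by (rule binomial_in_ideal_gen_congruence[where R = "\<lambda>u v. graph_degree ends u = graph_degree ends v",
        OF _ _ *[unfolded toric_ideal_def]])
      (auto simp: graph_degree_add equivp_def fun_eq_iff)
  then show "balanced ends (net u v)" by (simp add: graph_degree_eq_iff)
next
  assume "balanced ends (net u v)"
  then show "(monomial u - monomial v :: ('e, 'k) edge_poly) \<in> toric_ideal ends"
    unfolding toric_ideal_def ideal_gen_def graph_degree_eq_iff[symmetric]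
    by (auto intro!: module.span_base[OF module_ring_mult])
qed

lemma balanced_diff: "balanced ends y \<Longrightarrow> balanced ends z \<Longrightarrow> balanced ends (\<lambda>e. c * y e - d * z e)"
  by (simp add: balanced_def sum_subtractf flip: sum_distrib_left)

lemma exponents_of_weight:
  fixes y :: "'e::finite \<Rightarrow> int"
  obtains u v where "net u v = y"
    "\<And>e. Poly_Mapping.lookup u e = nat (y e)" "\<And>e. Poly_Mapping.lookup v e = nat (- y e)"
proof -
  define u where "u = Abs_poly_mapping (\<lambda>e. nat (y e))"
  define v where "v = Abs_poly_mapping (\<lambda>e. nat (- y e))"
  have l: "Poly_Mapping.lookup u e = nat (y e)" "Poly_Mapping.lookup v e = nat (- y e)" for e
    by (simp_all add: u_def v_def)
  then show ?thesis using that[of u v] by (simp add: fun_eq_iff net_def)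
qed

subsection \<open>Exponents of walk binomials\<close>

text \<open>Positions start at 0, so this is the exponent of the first monomial of
  \<open>walk_binomial\<close>.\<close>

definition even_exp :: "'e list \<Rightarrow> ('e \<Rightarrow>\<^sub>0 nat)" where
  "even_exp es = (\<Sum>k<length es div 2. Poly_Mapping.single (es ! (2 * k)) 1)"

definition odd_exp :: "'e list \<Rightarrow> ('e \<Rightarrow>\<^sub>0 nat)" where
  "odd_exp es = (\<Sum>k<length es div 2. Poly_Mapping.single (es ! (2 * k + 1)) 1)"

lemma walk_binomial_eq: "walk_binomial es = monomial (even_exp es) - monomial (odd_exp es)"
  by (simp add: walk_binomial_def edge_var_def even_exp_def odd_exp_def monomial_sum)

lemma lookup_even_exp:
  assumes "even (length es)"
  shows "Poly_Mapping.lookup (even_exp es) e = card {k. k < length es \<and> even k \<and> es ! k = e}"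
proof -
  have "Poly_Mapping.lookup (even_exp es) e = card {k. k < length es div 2 \<and> es ! (2 * k) = e}"
    by (simp add: even_exp_def lookup_sum lookup_single when_def flip: sum.inter_filter)
  also have "\<dots> = card ((\<lambda>k. 2 * k) ` {k. k < length es div 2 \<and> es ! (2 * k) = e})"
    by (rule card_image[symmetric]) (simp add: inj_on_def)
  also have "(\<lambda>k. 2 * k) ` {k. k < length es div 2 \<and> es ! (2 * k) = e} =
      {k. k < length es \<and> even k \<and> es ! k = e}"
  proof (intro equalityI subsetI)
    fix k assume "k \<in> {k. k < length es \<and> even k \<and> es ! k = e}"
    then show "k \<in> (\<lambda>k. 2 * k) ` {k. k < length es div 2 \<and> es ! (2 * k) = e}"
      by (intro image_eqI[of _ _ "k div 2"]) (use assms in auto)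
  qed auto
  finally show ?thesis .
qed

lemma lookup_odd_exp:
  assumes "even (length es)"
  shows "Poly_Mapping.lookup (odd_exp es) e = card {k. k < length es \<and> odd k \<and> es ! k = e}"
proof -
  have "Poly_Mapping.lookup (odd_exp es) e = card {k. k < length es div 2 \<and> es ! (2 * k + 1) = e}"
    by (simp add: odd_exp_def lookup_sum lookup_single when_def flip: sum.inter_filter)
  also have "\<dots> = card ((\<lambda>k. 2 * k + 1) ` {k. k < length es div 2 \<and> es ! (2 * k + 1) = e})"
    by (rule card_image[symmetric]) (simp add: inj_on_def)
  also have "(\<lambda>k. 2 * k + 1) ` {k. k < length es div 2 \<and> es ! (2 * k + 1) = e} =
      {k. k < length es \<and> odd k \<and> es ! k = e}"
  proof (intro equalityI subsetI)
    fix k assume "k \<in> {k. k < length es \<and> odd k \<and> es ! k = e}"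
    then have k: "k < length es" "odd k" "es ! k = e" by auto
    then have "k = 2 * (k div 2) + 1" "k div 2 < length es div 2" using assms by presburger+
    then show "k \<in> (\<lambda>k. 2 * k + 1) ` {k. k < length es div 2 \<and> es ! (2 * k + 1) = e}"
      using k by (intro image_eqI[of _ _ "k div 2"]) auto
  qed auto
  finally show ?thesis .
qed

text \<open>The alternating count of the edges along the walk; common factors of the two monomials
  disappear from it.\<close>

definition walk_net :: "'e list \<Rightarrow> 'e \<Rightarrow> int" where
  "walk_net es = net (even_exp es) (odd_exp es)"

lemma walk_net_eq_sum:
  assumes "even (length es)"
  shows "walk_net es e = (\<Sum>k<length es. if es ! k = e then (-1) ^ k else 0)"
proof -
  have "(\<Sum>k<length es. if es ! k = e then (-1) ^ k else (0::int)) =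
      (\<Sum>k<length es. (if even k \<and> es ! k = e then 1 else 0) - (if odd k \<and> es ! k = e then 1 else 0))"
    by (intro sum.cong) auto
  also have "\<dots> = walk_net es e"
    by (simp add: walk_net_def net_def lookup_even_exp lookup_odd_exp assms sum_subtractf
        flip: sum.inter_filter)
  finally show ?thesis by simp
qed

lemma walk_net_eq_0:
  assumes "even (length es)" "e \<notin> set es"
  shows "walk_net es e = 0"
  using assms by (auto simp: walk_net_eq_sum intro!: sum.neutral)

lemma even_exp_pos:
  assumes "even (length es)"
  shows "Poly_Mapping.lookup (even_exp es) e > 0 \<longleftrightarrow> (\<exists>k<length es. even k \<and> es ! k = e)"
  using assms by (auto simp: lookup_even_exp card_gt_0_iff)

lemma odd_exp_pos:
  assumes "even (length es)"
  shows "Poly_Mapping.lookup (odd_exp es) e > 0 \<longleftrightarrow> (\<exists>k<length es. odd k \<and> es ! k = e)"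
  using assms by (auto simp: lookup_odd_exp card_gt_0_iff)

lemma poly_supp_binomial:
  assumes "a \<noteq> b"
  shows "poly_supp (monomial a - monomial b :: ('e, 'k::field) edge_poly) =
    {e. Poly_Mapping.lookup a e > 0 \<or> Poly_Mapping.lookup b e > 0}"
  using assms by (auto simp: poly_supp_def keys_binomial in_keys_iff)

lemma poly_supp_walk_binomial:
  assumes "even (length es)" and "(walk_binomial es :: ('e, 'k::field) edge_poly) \<noteq> 0"
  shows "poly_supp (walk_binomial es :: ('e, 'k) edge_poly) = set es"
proof -
  have "even_exp es \<noteq> odd_exp es" using assms(2) by (auto simp: walk_binomial_eq)
  then show ?thesis using assms(1)
    by (auto simp: walk_binomial_eq poly_supp_binomial even_exp_pos odd_exp_pos in_set_conv_nth) blast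
qed

subsection \<open>Walks\<close>

lemma ends_neq:
  assumes "simple_graph ends" "ends e = {p, q}"
  shows "p \<noteq> q"
proof
  assume "p = q"
  then have "card (ends e) = 1" using assms by simp
  then show False using assms(1) by (auto simp only: simple_graph_def dest: spec[of _ e])
qed

lemma even_closed_walkD:
  assumes "even_closed_walk ends vs es"
  shows "even (length es)" "es \<noteq> []" "length vs = Suc (length es)"
    "\<And>k. k < length es \<Longrightarrow> ends (es ! k) = {vs ! k, vs ! Suc k}" "vs ! length es = vs ! 0"
proof -
  show *: "even (length es)" "es \<noteq> []" "length vs = Suc (length es)"
    "\<And>k. k < length es \<Longrightarrow> ends (es ! k) = {vs ! k, vs ! Suc k}"
    using assms by (auto simp: even_closed_walk_def closed_walk_def walk_def)
  then have "vs \<noteq> []" by auto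
  then show "vs ! length es = vs ! 0"
    using assms * by (simp add: even_closed_walk_def closed_walk_def last_conv_nth hd_conv_nth)
qed

lemma set_walk:
  assumes "walk ends vs es"
  shows "set vs = \<Union> (ends ` set es)"
proof -
  have es: "es \<noteq> []" "length vs = Suc (length es)" "\<And>k. k < length es \<Longrightarrow> ends (es ! k) = {vs ! k, vs ! Suc k}"
    using assms by (auto simp: walk_def)
  have "vs ! k \<in> \<Union> (ends ` set es)" if "k < length vs" for k
  proof (cases "k < length es")
    case True
    then show ?thesis using es(3)[OF True] by (intro UN_I[of "es ! k"]) auto
  next
    case False
    then have "k = Suc (k - 1)" "k - 1 < length es" using es that by (cases es; auto)+
    then show ?thesis using es(3)[of "k - 1"] by (intro UN_I[of "es ! (k - 1)"]) auto
  qed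
  moreover have "ends e \<subseteq> set vs" if e: "e \<in> set es" for e
  proof -
    obtain i where "i < length es" "e = es ! i" using e by (auto simp: in_set_conv_nth)
    then show ?thesis using es(2,3) by simp
  qed
  ultimately show ?thesis by (auto simp: in_set_conv_nth[of _ vs])
qed

text \<open>At a vertex the sum telescopes, because consecutive edges share a vertex and have
  opposite signs. The two boundary terms cancel since the walk is closed and even.\<close>

lemma balanced_walk_net:
  assumes "simple_graph ends" and w: "even_closed_walk ends vs es"
  shows "balanced ends (walk_net es)"
proof -
  let ?n = "length es"
  have ev: "even ?n" and ends: "\<And>k. k < ?n \<Longrightarrow> ends (es ! k) = {vs ! k, vs ! Suc k}"
    and len: "length vs = Suc ?n" and closed: "vs ! ?n = vs ! 0"
    using even_closed_walkD[OF w] by blast+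
  have "(\<Sum>e | v \<in> ends e. walk_net es e) = 0" for v
  proof -
    define h :: "nat \<Rightarrow> int" where "h k = (if vs ! k = v then 1 else 0)" for k
    have "(\<Sum>e | v \<in> ends e. walk_net es e) =
        (\<Sum>k<?n. \<Sum>e | v \<in> ends e. if es ! k = e then (-1) ^ k else 0)"
      unfolding walk_net_eq_sum[OF ev] by (rule sum.swap)
    also have "\<dots> = (\<Sum>k<?n. (-1) ^ k * (h k + h (Suc k)))"
    proof (rule sum.cong[OF refl])
      fix k assume "k \<in> {..<?n}"
      then have k: "ends (es ! k) = {vs ! k, vs ! Suc k}" using ends by simp
      from ends_neq[OF assms(1) this] show "(\<Sum>e | v \<in> ends e. if es ! k = e then (-1) ^ k else 0) =
          (-1) ^ k * (h k + h (Suc k))"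
        using k by (auto simp: h_def)
    qed
    also have "\<dots> = h 0 - (-1) ^ ?n * h ?n"
    proof -
      have "(\<Sum>k<n. (-1) ^ k * (h k + h (Suc k))) = h 0 - (-1) ^ n * h n" for n
        by (induction n) (auto simp: algebra_simps)
      then show ?thesis .
    qed
    also have "\<dots> = 0" using ev closed by (simp add: h_def)
    finally show ?thesis .
  qed
  then show ?thesis by (simp add: balanced_def)
qed

text \<open>\<open>V\<close> and \<open>E\<close> are functions of the position, so that segments
  can be cut from infinite walks as well as from lists.\<close>

lemma even_closed_walk_segment:
  assumes "i < j" "even (j - i)" "V i = V j"
    and "\<And>k. i \<le> k \<Longrightarrow> k < j \<Longrightarrow> ends (E k) = {V k, V (Suc k)}"
  shows "even_closed_walk ends (map V [i..<Suc j]) (map E [i..<j])"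
proof -
  have "(map V [i..<Suc j]) ! k = V (i + k)" if "k \<le> j - i" for k
    using that \<open>i < j\<close> by (simp only: length_upt nth_map nth_upt)
  then show ?thesis
    using assms by (auto simp: even_closed_walk_def closed_walk_def walk_def last_map hd_map Suc_diff_le
        simp del: upt_Suc)
qed

text \<open>At a vertex of the support there are edges of both signs, so a walk alternating in sign can
  be continued forever; it closes up when a vertex recurs at even positions.\<close>

lemma ex_alternating_walk:
  fixes ends :: "'e::finite \<Rightarrow> 'v::finite set"
  assumes simple: "simple_graph ends" and bal: "balanced ends y" and "y e0 \<noteq> 0"
  obtains vs es where "even_closed_walk ends vs es"
    "\<And>k. k < length es \<Longrightarrow> even k \<Longrightarrow> y (es ! k) > 0"
    "\<And>k. k < length es \<Longrightarrow> odd k \<Longrightarrow> y (es ! k) < 0"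
proof -
  \<comment> \<open>By balance, a vertex that meets any edge of nonzero weight lies in
    \<open>P\<close>.\<close>
  define P where "P = {v. \<exists>e. v \<in> ends e \<and> y e > 0}"
  have both: "(\<exists>e. v \<in> ends e \<and> y e > 0) \<and> (\<exists>e. v \<in> ends e \<and> y e < 0)"
    if "v \<in> ends e" "y e \<noteq> 0" for v e
  proof -
    have s: "(\<Sum>e | v \<in> ends e. y e) = 0" using bal by (simp add: balanced_def)
    show ?thesis
    proof (intro conjI; rule ccontr)
      assume "\<not> (\<exists>e. v \<in> ends e \<and> y e > 0)"
      then have "\<forall>e\<in>{e. v \<in> ends e}. 0 \<le> - y e" by (auto simp: not_less)
      then have "\<forall>e\<in>{e. v \<in> ends e}. - y e = 0"
        using s by (subst sum_nonneg_eq_0_iff[symmetric]) (auto simp: sum_negf)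
      then show False using that by auto
    next
      assume "\<not> (\<exists>e. v \<in> ends e \<and> y e < 0)"
      then have "\<forall>e\<in>{e. v \<in> ends e}. 0 \<le> y e" by (auto simp: not_less)
      then have "\<forall>e\<in>{e. v \<in> ends e}. y e = 0"
        using s by (subst sum_nonneg_eq_0_iff[symmetric]) auto
      then show False using that by auto
    qed
  qed
  have other: "\<exists>q. ends e = {p, q}" if "p \<in> ends e" for p e
    using simple that unfolding simple_graph_def card_2_iff by (metis insertE insert_commute singletonD)
  define good where "good n e \<longleftrightarrow> (if even n then y e > 0 else y e < (0::int))" for n :: nat and e
  have step: "\<exists>q\<in>P. \<exists>e. ends e = {p, q} \<and> good n e" if p: "p \<in> P" for p n
  proof -
    have "(\<exists>e. p \<in> ends e \<and> y e > 0) \<and> (\<exists>e. p \<in> ends e \<and> y e < 0)"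
      using p both unfolding P_def by fastforce
    then obtain e where e: "p \<in> ends e" "good n e"
      unfolding good_def by (cases "even n") auto
    then obtain q where "ends e = {p, q}" using other by blast
    moreover from this have "q \<in> P" using both[of q e] e unfolding P_def good_def
      by (auto split: if_splits)
    ultimately show ?thesis using e by blast
  qed
  have "card (ends e0) = 2" using simple by (simp add: simple_graph_def)
  then obtain p0 where "p0 \<in> ends e0" by fastforce
  then have "p0 \<in> P" using both assms(3) by (auto simp: P_def)
  then have "\<exists>V. \<forall>n. V n \<in> P \<and> (\<exists>e. ends e = {V n, V (Suc n)} \<and> good n e)"
    using step dependent_nat_choice[of "\<lambda>_ v. v \<in> P" "\<lambda>n p q. \<exists>e. ends e = {p, q} \<and> good n e"]
    by blast
  then obtain V where "\<And>n. \<exists>e. ends e = {V n, V (Suc n)} \<and> good n e" by blast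
  then obtain E where E: "\<And>n. ends (E n) = {V n, V (Suc n)}" "\<And>n. good n (E n)" by metis
  have "\<not> inj (\<lambda>n. V (2 * n))"
    using finite_imageD[of "\<lambda>n. V (2 * n)" UNIV] by auto
  then obtain i j where ij: "i < j" "V (2 * i) = V (2 * j)"
    unfolding inj_def by (metis linorder_neqE_nat)
  show ?thesis
  proof (rule that)
    \<comment> \<open>The even starting position makes parities in the list agree with the parities
      of the indices of \<open>E\<close>.\<close>
    show "even_closed_walk ends (map V [2 * i..<Suc (2 * j)]) (map E [2 * i..<2 * j])"
      using ij E by (intro even_closed_walk_segment) auto
  qed (use E(2) ij in \<open>auto simp: good_def dest: spec split: if_splits\<close>)
qed

section \<open>Linking vertices by walks of controlled parity\<close>

text \<open>Walks of given length within an edge set, keeping only their two ends. Length 0 is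
  allowed, unlike for \<open>walk\<close>, so that links compose without case distinctions.\<close>

inductive link :: "('e::finite \<Rightarrow> 'v::finite set) \<Rightarrow> 'e set \<Rightarrow> nat \<Rightarrow> 'v \<Rightarrow> 'v \<Rightarrow> bool" for ends S where
  nil: "link ends S 0 p p"
| cons: "e \<in> S \<Longrightarrow> ends e = {p, r} \<Longrightarrow> link ends S n r q \<Longrightarrow> link ends S (Suc n) p q"

lemma link_trans:
  assumes "link ends S m p q" "link ends S n q r"
  shows "link ends S (m + n) p r"
  using assms by (induction rule: link.induct) (auto intro: link.cons)

lemma link_edge: "e \<in> S \<Longrightarrow> ends e = {p, r} \<Longrightarrow> link ends S 1 p r"
  by (metis One_nat_def link.nil link.cons)

lemma link_sym: "link ends S n p q \<Longrightarrow> link ends S n q p"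
proof (induction rule: link.induct)
  case (cons e p r n q)
  then have "link ends S 1 r p" by (intro link_edge[of e]) auto
  from link_trans[OF cons.IH this] show ?case by simp
qed (rule link.nil)

lemma link_mono: "link ends S n p q \<Longrightarrow> S \<subseteq> T \<Longrightarrow> link ends T n p q"
  by (induction rule: link.induct) (auto intro: link.intros)

lemma link_imp_walk:
  assumes "link ends S n p q"
  shows "\<exists>vs es. length es = n \<and> length vs = Suc n \<and> vs ! 0 = p \<and> vs ! n = q \<and> set es \<subseteq> S \<and>
    (\<forall>k<n. ends (es ! k) = {vs ! k, vs ! Suc k})"
  using assms
proof (induction rule: link.induct)
  case (nil p)
  show ?case by (intro exI[of _ "[p]"] exI[of _ "[]"]) auto
next
  case (cons e p r n q)
  then obtain vs es where "length es = n" "length vs = Suc n" "vs ! 0 = r" "vs ! n = q" "set es \<subseteq> S"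
    "\<forall>k<n. ends (es ! k) = {vs ! k, vs ! Suc k}" by blast
  then show ?case using cons.hyps
    by (intro exI[of _ "p # vs"] exI[of _ "e # es"]) (auto simp: nth_Cons split: nat.splits)
qed

lemma walk_link:
  assumes "\<And>k. k < length es \<Longrightarrow> ends (es ! k) = {vs ! k, vs ! Suc k}" "i + n \<le> length es"
  shows "link ends (set es) n (vs ! i) (vs ! (i + n))"
  using assms(2)
proof (induction n)
  case 0
  show ?case by (simp add: link.nil)
next
  case (Suc n)
  then have "link ends (set es) n (vs ! i) (vs ! (i + n))" by simp
  moreover have "link ends (set es) 1 (vs ! (i + n)) (vs ! Suc (i + n))"
    using Suc.prems by (intro link_edge[of "es ! (i + n)"] assms(1)) auto
  ultimately have "link ends (set es) (n + 1) (vs ! i) (vs ! Suc (i + n))" by (rule link_trans)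
  then show ?case by simp
qed

subsection \<open>Even closed walks with nonzero binomial\<close>

locale even_walk =
  fixes ends :: "'e::finite \<Rightarrow> 'v::finite set" and vs :: "'v list" and es :: "'e list"
    and K :: "'k::field itself"
  assumes simple: "simple_graph ends"
    and walk: "even_closed_walk ends vs es"
    and nonzero: "(walk_binomial es :: ('e, 'k) edge_poly) \<noteq> 0"
begin

abbreviation "len \<equiv> length es"
abbreviation "a \<equiv> even_exp es"
abbreviation "b \<equiv> odd_exp es"
abbreviation "B \<equiv> (walk_binomial es :: ('e, 'k) edge_poly)"
abbreviation "G\<^sub>w \<equiv> induced_edges ends (set vs)"

lemmas walkD = even_closed_walkD[OF walk]

lemma len_pos: "0 < len" "Suc 0 < len"
proof -
  show "0 < len" using walkD(2) by simp
  then show "Suc 0 < len" using walkD(1) by presburger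
qed

lemma a_neq_b: "a \<noteq> b"
  using nonzero by (auto simp: walk_binomial_eq)

lemma a_neq_0: "a \<noteq> 0" and b_neq_0: "b \<noteq> 0"
proof -
  have "Poly_Mapping.lookup a (es ! 0) > 0" "Poly_Mapping.lookup b (es ! 1) > 0"
    using walkD(1) len_pos by (auto simp: even_exp_pos odd_exp_pos intro: exI[of _ "1::nat"])
  then show "a \<noteq> 0" "b \<noteq> 0" by auto
qed

lemma set_vs: "set vs = \<Union> (ends ` set es)"
  using walk by (intro set_walk) (simp add: even_closed_walk_def closed_walk_def)

lemma set_es_induced: "set es \<subseteq> G\<^sub>w"
  by (auto simp: induced_edges_def set_vs)

lemma vertex_position: "v \<in> set vs \<Longrightarrow> \<exists>i<len. vs ! i = v"
proof -
  assume "v \<in> set vs"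
  then obtain i where i: "i < Suc len" "vs ! i = v" using walkD(3) by (auto simp: in_set_conv_nth)
  show ?thesis
  proof (cases "i = len")
    case True
    then show ?thesis using i walkD(5) len_pos by auto
  next
    case False
    then show ?thesis using i by (auto simp: less_Suc_eq)
  qed
qed

lemma net_balanced: "balanced ends (walk_net es)"
  using balanced_walk_net[OF simple walk] .

lemma B_in_toric: "B \<in> toric_ideal ends"
  using net_balanced by (simp add: walk_binomial_eq binomial_in_toric_ideal_iff walk_net_def)

lemma B_supp: "poly_supp B = set es"
  using poly_supp_walk_binomial[OF walkD(1) nonzero] .

lemma chord_positions:
  assumes "chord ends vs es f"
  obtains i j where "i < j" "j < len" "ends f = {vs ! i, vs ! j}"
proof -
  have "card (ends f) = 2" using simple by (simp add: simple_graph_def)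
  then obtain p q where pq: "ends f = {p, q}" "p \<noteq> q" by (auto simp: card_2_iff)
  then have "p \<in> set vs" "q \<in> set vs" using assms by (auto simp: chord_def)
  then obtain i j where ij: "i < len" "vs ! i = p" "j < len" "vs ! j = q"
    using vertex_position by blast
  then have "i \<noteq> j" using pq by auto
  then consider "i < j" | "j < i" by linarith
  then show ?thesis using that[of i j] that[of j i] ij pq by cases auto
qed

text \<open>The two pieces have lengths \<open>len - (j - i) + 1\<close> and
  \<open>j - i + 1\<close>, and \<open>len\<close> is even.\<close>

lemma breaks_parity:
  assumes "i < j" "j < len"
  shows "even (length (take i es @ [f] @ drop j es)) \<and> even (length (drop i (take j es) @ [f]))
      \<longleftrightarrow> odd (j - i)"
    and "odd (length (take i es @ [f] @ drop j es)) \<and> odd (length (drop i (take j es) @ [f]))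
      \<longleftrightarrow> even (j - i)"
proof -
  have "length (take i es @ [f] @ drop j es) = i + (1 + (len - j))" using assms by simp
  then have "even (length (take i es @ [f] @ drop j es)) \<longleftrightarrow> odd (j - i)"
    using assms walkD(1) by presburger
  moreover have "even (length (drop i (take j es) @ [f])) \<longleftrightarrow> odd (j - i)"
    using assms by simp
  ultimately show "even (length (take i es @ [f] @ drop j es)) \<and> even (length (drop i (take j es) @ [f]))
      \<longleftrightarrow> odd (j - i)"
    "odd (length (take i es @ [f] @ drop j es)) \<and> odd (length (drop i (take j es) @ [f]))
      \<longleftrightarrow> even (j - i)"
    by blast+
qed

lemma even_chord_iff:
  "even_chord ends vs es f \<longleftrightarrow> chord ends vs es f \<and>
    (\<exists>i j. i < j \<and> j < len \<and> ends f = {vs ! i, vs ! j} \<and> odd (j - i))"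
proof -
  have "(\<exists>w1 w2. breaks_into ends vs es f w1 w2 \<and> even (length w1) \<and> even (length w2)) \<longleftrightarrow>
    (\<exists>i j. i < j \<and> j < len \<and> ends f = {vs ! i, vs ! j} \<and>
      even (length (take i es @ [f] @ drop j es)) \<and> even (length (drop i (take j es) @ [f])))"
    unfolding breaks_into_def by blast
  also have "\<dots> \<longleftrightarrow> (\<exists>i j. i < j \<and> j < len \<and> ends f = {vs ! i, vs ! j} \<and> odd (j - i))"
    by (intro ex_cong1 conj_cong refl breaks_parity(1))
  finally show ?thesis
    unfolding even_chord_def by blast
qed

lemma odd_chord_iff:
  "odd_chord ends vs es f \<longleftrightarrow> chord ends vs es f \<and>
    (\<exists>i j. i < j \<and> j < len \<and> ends f = {vs ! i, vs ! j} \<and> even (j - i))"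
proof -
  have "(\<exists>w1 w2. breaks_into ends vs es f w1 w2 \<and> odd (length w1) \<and> odd (length w2)) \<longleftrightarrow>
    (\<exists>i j. i < j \<and> j < len \<and> ends f = {vs ! i, vs ! j} \<and>
      odd (length (take i es @ [f] @ drop j es)) \<and> odd (length (drop i (take j es) @ [f])))"
    unfolding breaks_into_def by blast
  also have "\<dots> \<longleftrightarrow> (\<exists>i j. i < j \<and> j < len \<and> ends f = {vs ! i, vs ! j} \<and> even (j - i))"
    by (intro ex_cong1 conj_cong refl breaks_parity(2))
  finally show ?thesis
    unfolding odd_chord_def by blast
qed

lemma chord_parity: "chord ends vs es f \<Longrightarrow> even_chord ends vs es f \<or> odd_chord ends vs es f"
  unfolding even_chord_iff odd_chord_iff by (metis chord_positions)

end

section \<open>Fundamental walks: circuit and chord conditions\<close>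

locale fundamental_even_walk = even_walk ends vs es K
  for ends :: "'e::finite \<Rightarrow> 'v::finite set" and vs :: "'v list" and es :: "'e list"
    and K :: "'k::field itself" +
  assumes fundamental: "\<And>vs' es'. even_closed_walk ends vs' es' \<Longrightarrow> set es' \<subseteq> G\<^sub>w \<Longrightarrow>
    B dvd walk_binomial es'"
begin

lemma net_multiple:
  assumes "even_closed_walk ends vs' es'" "set es' \<subseteq> G\<^sub>w"
  obtains k where "\<And>e. walk_net es' e = k * walk_net es e"
  using binomial_dvd_imp_net_multiple fundamental[OF assms]
  unfolding walk_binomial_eq walk_net_def by blast

text \<open>A walk that alternates between positive and negative edges of \<open>walk_net es\<close>
  has a nonzero binomial with coprime monomials. It stays inside \<open>w\<close>, so
  \<open>B\<close> divides its binomial, and a variable common to \<open>a\<close> and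
  \<open>b\<close> would have to divide both of its monomials.\<close>

lemma coprime: "Poly_Mapping.lookup a e = 0 \<or> Poly_Mapping.lookup b e = 0"
proof (rule ccontr)
  assume e: "\<not> ?thesis"
  have "walk_net es \<noteq> (\<lambda>_. 0)" using a_neq_b by (simp add: walk_net_def net_eq_0_iff)
  then obtain e0 where "walk_net es e0 \<noteq> 0" by auto
  from ex_alternating_walk[OF simple net_balanced this] obtain vs' es'
    where w': "even_closed_walk ends vs' es'"
      and pos: "\<And>k. k < length es' \<Longrightarrow> even k \<Longrightarrow> walk_net es (es' ! k) > 0"
      and neg: "\<And>k. k < length es' \<Longrightarrow> odd k \<Longrightarrow> walk_net es (es' ! k) < 0" by blast
  note w'D = even_closed_walkD[OF w']
  have "e' \<in> set es" if "e' \<in> set es'" for e'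
  proof (rule ccontr)
    assume "e' \<notin> set es"
    then have "walk_net es e' = 0" using walkD(1) by (simp add: walk_net_eq_0)
    then show False using that pos neg by (metis in_set_conv_nth less_irrefl)
  qed
  then have "set es' \<subseteq> G\<^sub>w" using set_es_induced by blast
  from fundamental[OF w' this] have
    "even_exp es' = odd_exp es' \<or>
      Poly_Mapping.lookup (even_exp es') e > 0 \<and> Poly_Mapping.lookup (odd_exp es') e > 0"
    using binomial_dvd_common_variable[of a b "even_exp es'" "odd_exp es'" e] e
    unfolding walk_binomial_eq by blast
  moreover have "Poly_Mapping.lookup (even_exp es') (es' ! 0) > 0"
    using w'D(1,2) by (auto simp: even_exp_pos)
  ultimately obtain e' where
    "Poly_Mapping.lookup (even_exp es') e' > 0 \<and> Poly_Mapping.lookup (odd_exp es') e' > 0"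
    by metis
  then show False using pos neg w'D(1) by (auto simp: even_exp_pos odd_exp_pos) (metis less_asym)
qed

text \<open>An edge occurring at positions of both parities would divide both monomials.\<close>

lemma edge_parity:
  assumes "s < len" "t < len" "es ! s = es ! t"
  shows "even s \<longleftrightarrow> even t"
  using coprime[of "es ! t"] assms walkD(1)
  by (metis even_exp_pos odd_exp_pos less_irrefl)

text \<open>All occurrences of an edge carry the same sign, so an alternating sum is a signed count
  without cancellation.\<close>

lemma segment_net:
  assumes "t < len" "i \<le> j" "j \<le> len"
  shows "(\<Sum>k\<in>{i..<j}. if es ! k = es ! t then (-1) ^ k else (0::int)) =
    (-1) ^ t * int (card {k\<in>{i..<j}. es ! k = es ! t})"
proof -
  have "(\<Sum>k\<in>{i..<j}. if es ! k = es ! t then (-1) ^ k else (0::int)) =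
      (\<Sum>k\<in>{i..<j}. if es ! k = es ! t then (-1) ^ t else 0)"
  proof (rule sum.cong[OF refl])
    fix k assume "k \<in> {i..<j}"
    then have "k < len" using assms by simp
    then show "(if es ! k = es ! t then (-1) ^ k else (0::int)) = (if es ! k = es ! t then (-1) ^ t else 0)"
      using edge_parity[OF \<open>k < len\<close> assms(1)] by (simp only: minus_one_power_iff split: if_split) blast
  qed
  then show ?thesis by (simp flip: sum.inter_filter)
qed

lemma net_edge:
  assumes "t < len"
  shows "walk_net es (es ! t) = (-1) ^ t * int (card {k. k < len \<and> es ! k = es ! t})"
  using segment_net[of t 0 len] assms walkD(1)
  by (simp add: walk_net_eq_sum atLeast0LessThan)

lemma in_set_iff_net: "walk_net es e \<noteq> 0 \<longleftrightarrow> e \<in> set es"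
proof
  assume "e \<in> set es"
  then obtain t where t: "t < len" "es ! t = e" by (auto simp: in_set_conv_nth)
  then have "card {k. k < len \<and> es ! k = es ! t} \<noteq> 0" by auto
  then show "walk_net es e \<noteq> 0" using net_edge[OF t(1)] t(2) by simp
qed (use walk_net_eq_0[OF walkD(1), of e] in blast)

text \<open>A proper even closed segment of the walk would have a net vector that is a positive multiple
  of the whole one although it uses some edge less often.\<close>

lemma no_even_closed_segment:
  assumes "i < j" "j \<le> len" "even (j - i)" "vs ! i = vs ! j"
  shows "i = 0 \<and> j = len"
proof (rule ccontr)
  assume *: "\<not> ?thesis"
  define es' where "es' = map ((!) es) [i..<j]"
  have w': "even_closed_walk ends (map ((!) vs) [i..<Suc j]) es'"
    unfolding es'_def using assms walkD(4) by (intro even_closed_walk_segment) auto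
  have len': "length es' = j - i" by (simp add: es'_def)
  have "set es' \<subseteq> set es" using assms by (auto simp: es'_def)
  then obtain k where k: "\<And>e. walk_net es' e = k * walk_net es e"
    using net_multiple[OF w'] set_es_induced by blast
  let ?c = "\<lambda>t. card {k. k < len \<and> es ! k = es ! t}"
  let ?c' = "\<lambda>t. card {k\<in>{i..<j}. es ! k = es ! t}"
  have net': "walk_net es' (es ! t) = (-1) ^ i * ((-1) ^ t * int (?c' t))" if "t < len" for t
  proof -
    have "walk_net es' (es ! t) = (\<Sum>k<j - i. if es ! (i + k) = es ! t then (-1) ^ k else 0)"
      using assms(3) by (simp add: walk_net_eq_sum len') (simp add: es'_def)
    also have "\<dots> = (\<Sum>k\<in>{i..<j}. if es ! k = es ! t then (-1) ^ (k - i) else 0)"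
      by (rule sum.reindex_bij_witness[of _ "\<lambda>k. k - i" "\<lambda>k. i + k"]) auto
    also have "\<dots> = (\<Sum>k\<in>{i..<j}. (-1) ^ i * (if es ! k = es ! t then (-1) ^ k else 0))"
      by (intro sum.cong) (auto simp: minus_one_power_iff)
    also have "\<dots> = (-1) ^ i * ((-1) ^ t * int (?c' t))"
      using segment_net[of t i j] that assms by (simp flip: sum_distrib_left)
    finally show ?thesis .
  qed
  \<comment> \<open>The sign of \<open>t\<close> cancels; the remaining factor is the same for all
    edges and corrects for a segment that starts at an odd position.\<close>
  have mult: "int (?c' t) = ((-1) ^ i * k) * int (?c t)" if "t < len" for t
    using k[of "es ! t"] net'[OF that] net_edge[OF that] by (auto simp: minus_one_power_iff split: if_splits)
  have "?c' i > 0" using assms by (auto simp: card_gt_0_iff)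
  then have "0 < ((-1) ^ i * k) * int (?c i)" using mult[of i] assms by linarith
  then have "0 < int (?c i) \<Longrightarrow> 0 < (-1) ^ i * k" by (rule zero_less_mult_pos2)
  moreover have "0 < int (?c i)" using assms by (auto simp: card_gt_0_iff intro: exI[of _ i])
  ultimately have "(-1) ^ i * k \<ge> 1" by linarith
  then have ge: "?c t \<le> ?c' t" if "t < len" for t
    using mult[OF that] mult_right_mono[of 1 "(-1) ^ i * k" "int (?c t)"] by linarith
  obtain t where t: "t < len" "t \<notin> {i..<j}"
    using * assms that[of 0] that[of j] len_pos by fastforce
  have "{k\<in>{i..<j}. es ! k = es ! t} \<subset> {k. k < len \<and> es ! k = es ! t}"
    using t assms by auto
  then have "?c' t < ?c t" by (intro psubset_card_mono) auto
  then show False using ge[OF t(1)] by simp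
qed

text \<open>Vertex and parity together determine a position, since two such positions would bound a
  proper even closed segment.\<close>

lemma same_state:
  assumes "i < len" "j < len" "vs ! i = vs ! j" "even i \<longleftrightarrow> even j"
  shows "i = j"
proof (rule ccontr)
  assume "i \<noteq> j"
  then consider "i < j" | "j < i" by linarith
  then show False
    using no_even_closed_segment[of i j] no_even_closed_segment[of j i] assms by cases auto
qed

text \<open>If every edge is repeated, each repetition runs in the opposite direction, and then the next
  edge is repeated strictly inside.\<close>

lemma ex_simple_edge: "\<exists>t<len. \<forall>s<len. es ! s = es ! t \<longrightarrow> s = t"
proof (rule ccontr)
  assume "\<not> ?thesis"
  then have twin: "\<exists>s<len. es ! s = es ! t \<and> s \<noteq> t" if "t < len" for t using that by blast
  \<comment> \<open>Both positions have the same parity, so running through the edge in the same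
    direction would repeat a state.\<close>
  have turn: "vs ! s = vs ! Suc t \<and> vs ! Suc s = vs ! t"
    if "s < len" "t < len" "es ! s = es ! t" "s \<noteq> t" for s t
  proof -
    have "{vs ! s, vs ! Suc s} = {vs ! t, vs ! Suc t}" using that walkD(4) by metis
    moreover have "vs ! s \<noteq> vs ! t" using same_state edge_parity that by blast
    ultimately show ?thesis by (auto simp: doubleton_eq_iff)
  qed
  have "False" if "t + n < len" "n > 0" "es ! t = es ! (t + n)" for t n
    using that
  proof (induction n arbitrary: t rule: less_induct)
    case (less n)
    let ?s = "t + n"
    have "even n" using edge_parity[of t ?s] less.prems by auto
    then have "n \<ge> 2" using less.prems by presburger
    have turn1: "vs ! ?s = vs ! Suc t" using turn[of ?s t] less.prems by auto
    \<comment> \<open>Otherwise the edge between the two occurrences would be a loop.\<close>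
    have "n \<noteq> 2"
    proof
      assume "n = 2"
      then have "ends (es ! Suc t) = {vs ! ?s, vs ! ?s}" using walkD(4)[of "Suc t"] less.prems turn1 by simp
      then show False using ends_neq[OF simple] by blast
    qed
    obtain r where r: "r < len" "es ! r = es ! Suc t" "r \<noteq> Suc t"
      using twin[of "Suc t"] less.prems \<open>n \<ge> 2\<close> by auto
    then have "vs ! Suc r = vs ! Suc t" using turn[of r "Suc t"] less.prems \<open>n \<ge> 2\<close> by simp
    then have vr: "vs ! Suc r = vs ! ?s" using turn1 by simp
    have par: "even (Suc r) \<longleftrightarrow> even ?s" using edge_parity[of r "Suc t"] r less.prems \<open>n \<ge> 2\<close> \<open>even n\<close> by simp
    \<comment> \<open>Both positions have the same vertex and parity. Position \<open>len\<close>
      has to be read as position 0, as states are compared only below \<open>len\<close>.\<close>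
    have "Suc r = ?s"
    proof (cases "Suc r = len")
      case True
      then have "0 = ?s" using vr par walkD(1,5) less.prems len_pos by (intro same_state) auto
      then show ?thesis using less.prems by simp
    next
      case False
      then show ?thesis using vr par r less.prems by (intro same_state) auto
    qed
    then have "r = Suc t + (n - 2)" using \<open>n \<ge> 2\<close> by simp
    then show False using less.IH[of "n - 2" "Suc t"] r less.prems \<open>n \<ge> 2\<close> \<open>n \<noteq> 2\<close> by auto
  qed
  moreover obtain s where "s < len" "es ! s = es ! 0" "s \<noteq> 0" using twin[of 0] len_pos by auto
  ultimately show False by (metis add_0 neq0_conv)
qed

text \<open>An edge traversed exactly once has net weight 1 or -1.\<close>

lemma primitive:
  assumes "\<And>e. d dvd walk_net es e"
  shows "d dvd 1"
proof -
  obtain t where t: "t < len" "\<forall>s<len. es ! s = es ! t \<longrightarrow> s = t" using ex_simple_edge by blast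
  then have "{k. k < len \<and> es ! k = es ! t} = {t}" by auto
  then have "walk_net es (es ! t) = (-1) ^ t" using net_edge[OF t(1)] by simp
  then show ?thesis using assms[of "es ! t"] by (auto simp: minus_one_power_iff split: if_splits)
qed

lemma irreducible_B: "irreducible B"
  unfolding walk_binomial_eq
  using a_neq_0 coprime primitive by (intro irreducible_binomialI) (auto simp: walk_net_def)

text \<open>A binomial of smaller support carries an alternating walk inside its support. The net
  vector of this walk is a nonzero multiple of \<open>walk_net es\<close>, hence nonzero on every
  edge of \<open>w\<close>, also on those outside the smaller support.\<close>

lemma circuit: "is_circuit ends B"
  unfolding is_circuit_def
proof (intro conjI notI)
  show "is_binomial B" by (auto simp: is_binomial_def walk_binomial_eq)
  assume "\<exists>B' :: ('e, 'k) edge_poly. is_binomial B' \<and> B' \<noteq> 0 \<and> B' \<in> toric_ideal ends \<and>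
    poly_supp B' \<subset> poly_supp B"
  then obtain u v where "(monomial u - monomial v :: ('e, 'k) edge_poly) \<noteq> 0"
    and tor: "(monomial u - monomial v :: ('e, 'k) edge_poly) \<in> toric_ideal ends"
    and supp: "poly_supp (monomial u - monomial v :: ('e, 'k) edge_poly) \<subset> set es"
    unfolding is_binomial_def B_supp by blast
  then have "u \<noteq> v" by auto
  have supp': "net u v e = 0" if "e \<notin> poly_supp (monomial u - monomial v :: ('e, 'k) edge_poly)" for e
    using that \<open>u \<noteq> v\<close> by (simp add: poly_supp_binomial net_def)
  have bal: "balanced ends (net u v)" using tor by (simp add: binomial_in_toric_ideal_iff)
  obtain e0 where "net u v e0 \<noteq> 0" using \<open>u \<noteq> v\<close> net_eq_0_iff[of u v] by auto
  from ex_alternating_walk[OF simple bal this] obtain vs' es'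
    where w': "even_closed_walk ends vs' es'"
      and pos: "\<And>k. k < length es' \<Longrightarrow> even k \<Longrightarrow> net u v (es' ! k) > 0"
      and neg: "\<And>k. k < length es' \<Longrightarrow> odd k \<Longrightarrow> net u v (es' ! k) < 0" by blast
  note w'D = even_closed_walkD[OF w']
  have sub: "set es' \<subseteq> poly_supp (monomial u - monomial v :: ('e, 'k) edge_poly)"
  proof
    fix e assume "e \<in> set es'"
    then have "net u v e \<noteq> 0" using pos neg by (metis in_set_conv_nth less_irrefl)
    then show "e \<in> poly_supp (monomial u - monomial v :: ('e, 'k) edge_poly)" using supp' by blast
  qed
  then obtain k where k: "\<And>e. walk_net es' e = k * walk_net es e"
    using net_multiple[OF w'] supp set_es_induced by blast
  \<comment> \<open>The first edge has positive weight and so never recurs at an odd position; hence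
    the net vector of the new walk is nonzero.\<close>
  have "Poly_Mapping.lookup (even_exp es') (es' ! 0) > 0"
    using w'D(1,2) by (auto simp: even_exp_pos)
  moreover have "Poly_Mapping.lookup (odd_exp es') (es' ! 0) = 0"
    using w'D(1,2) pos[of 0] neg odd_exp_pos[of es' "es' ! 0"] by (metis gr0I less_asym even_zero length_greater_0_conv)
  ultimately have "walk_net es' (es' ! 0) \<noteq> 0" by (simp add: walk_net_def net_def)
  then have "k \<noteq> 0" using k by auto
  obtain e where e: "e \<in> set es" "e \<notin> set es'" using sub supp by blast
  have "walk_net es' e = 0" using walk_net_eq_0[OF w'D(1) e(2)] .
  then show False using k[of e] \<open>k \<noteq> 0\<close> e(1) in_set_iff_net[of e] by simp
qed (use irreducible_B B_in_toric in auto)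

text \<open>Together with \<open>f\<close> an odd link would close to an even closed walk using
  \<open>f\<close> once. Its net weight at \<open>f\<close> is 1, whereas every multiple of
  \<open>walk_net es\<close> vanishes there.\<close>

lemma no_odd_link_around_chord:
  assumes f: "chord ends vs es f" "ends f = {p, q}"
    and link: "link ends (G\<^sub>w - {f}) n q p"
  shows "even n"
proof (rule ccontr)
  assume "odd n"
  obtain vs' es' where w': "length es' = n" "length vs' = Suc n" "vs' ! 0 = q" "vs' ! n = p"
    "set es' \<subseteq> G\<^sub>w - {f}" "\<And>k. k < n \<Longrightarrow> ends (es' ! k) = {vs' ! k, vs' ! Suc k}"
    using link_imp_walk[OF link] by blast
  have "even_closed_walk ends (p # vs') (f # es')"
    using w' f \<open>odd n\<close>
    by (auto simp: even_closed_walk_def closed_walk_def walk_def nth_Cons last_conv_nth split: nat.splits)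
  moreover have "set (f # es') \<subseteq> G\<^sub>w" using w'(5) f(1) by (auto simp: chord_def induced_edges_def)
  ultimately obtain k where k: "\<And>e. walk_net (f # es') e = k * walk_net es e"
    using net_multiple by blast
  have "walk_net es f = 0" using f(1) walkD(1) by (intro walk_net_eq_0) (auto simp: chord_def)
  then have "walk_net (f # es') f = 0" using k by simp
  moreover have "walk_net (f # es') f = 1"
  proof -
    have "walk_net (f # es') f = (\<Sum>k<Suc n. if (f # es') ! k = f then (-1) ^ k else 0)"
      using walk_net_eq_sum[of "f # es'"] w'(1) \<open>odd n\<close> by simp
    also have "\<dots> = 1 + (\<Sum>k<n. if es' ! k = f then (-1) ^ Suc k else 0)"
      by (subst sum.lessThan_Suc_shift) simp
    also have "(\<Sum>k<n. if es' ! k = f then (-1) ^ Suc k else (0::int)) = 0"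
      using w'(1,5) by (intro sum.neutral) (auto dest: nth_mem)
    finally show ?thesis by simp
  qed
  ultimately show False by simp
qed

lemma position_link:
  assumes "i \<le> len" "j \<le> len"
  obtains n where "link ends (set es) n (vs ! i) (vs ! j)" "even n \<longleftrightarrow> even (i + j)"
proof (cases "i \<le> j")
  case True
  then have "link ends (set es) (j - i) (vs ! i) (vs ! j)"
    using walk_link[of es ends vs i "j - i"] walkD(4) assms by simp
  then show ?thesis by (rule that) (use True in auto)
next
  case False
  then have "link ends (set es) (i - j) (vs ! i) (vs ! j)"
    using walk_link[of es ends vs j "i - j"] walkD(4) assms by (simp add: link_sym)
  then show ?thesis by (rule that) (use False in auto)
qed

lemma chord_free_link:
  assumes "link ends (set es) n p q" "chord ends vs es f"
  shows "link ends (G\<^sub>w - {f}) n p q"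
  using assms(1) by (rule link_mono) (use set_es_induced assms(2) in \<open>auto simp: chord_def\<close>)

text \<open>The part of \<open>w\<close> between the two positions links the ends of
  \<open>f\<close> without using \<open>f\<close>.\<close>

lemma chord_even_distance:
  assumes f: "chord ends vs es f" and ij: "i < len" "j < len" "ends f = {vs ! i, vs ! j}"
  shows "even (i + j)"
proof -
  obtain n where n: "link ends (set es) n (vs ! j) (vs ! i)" "even n \<longleftrightarrow> even (j + i)"
    using position_link[of j i] ij by auto
  have "link ends (G\<^sub>w - {f}) n (vs ! j) (vs ! i)"
    using n(1) f by (rule chord_free_link)
  from no_odd_link_around_chord[OF f ij(3) this] show ?thesis using n(2) by (simp add: add.commute)
qed

lemma no_even_chord: "\<not> even_chord ends vs es f"
  unfolding even_chord_iff using chord_even_distance[of f] by fastforce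

text \<open>The ends of \<open>f\<close> are linked by following \<open>w\<close> to one end of
  \<open>g\<close>, crossing \<open>g\<close>, and following \<open>w\<close> again. As both chords
  join positions of equal parity, the edge \<open>g\<close> makes the total length odd.\<close>

lemma at_most_one_chord:
  assumes f: "chord ends vs es f" and g: "chord ends vs es g"
  shows "f = g"
proof (rule ccontr)
  assume "f \<noteq> g"
  obtain i j where ij: "i < j" "j < len" "ends f = {vs ! i, vs ! j}" using chord_positions[OF f] .
  obtain k l where kl: "k < l" "l < len" "ends g = {vs ! k, vs ! l}" using chord_positions[OF g] .
  let ?S = "G\<^sub>w - {f}"
  obtain m where m: "link ends (set es) m (vs ! j) (vs ! k)" "even m \<longleftrightarrow> even (j + k)"
    using position_link[of j k] ij kl by auto
  obtain n where n: "link ends (set es) n (vs ! l) (vs ! i)" "even n \<longleftrightarrow> even (l + i)"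
    using position_link[of l i] ij kl by auto
  have "link ends ?S 1 (vs ! k) (vs ! l)"
    using g \<open>f \<noteq> g\<close> kl(3) by (intro link_edge[of g]) (auto simp: chord_def induced_edges_def)
  then have "link ends ?S (m + (1 + n)) (vs ! j) (vs ! i)"
    using chord_free_link[OF m(1) f] chord_free_link[OF n(1) f] link_trans by metis
  then have "even (m + (1 + n))" using no_odd_link_around_chord[OF f ij(3)] by blast
  moreover have "even (i + j)" "even (k + l)"
    using chord_even_distance f g ij kl by auto
  ultimately show False using m(2) n(2) by auto
qed

text \<open>The walk revisits some vertex, hence contains an odd closed segment, so its vertices are
  linked by walks of both parities.\<close>

lemma no_chord_unless_cycle:
  assumes "\<not> is_cycle ends vs es"
  shows "\<not> chord ends vs es f"
proof
  assume f: "chord ends vs es f"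
  have "\<not> distinct (butlast vs)"
    using assms walk by (simp add: is_cycle_def even_closed_walk_def)
  then obtain i j where ij: "i < len" "j < len" "i \<noteq> j" "vs ! i = vs ! j"
    using walkD(3) by (auto simp: distinct_conv_nth nth_butlast)
  then have odd: "odd (i + j)" using same_state[of i j] by auto
  obtain s t where st: "s < t" "t < len" "ends f = {vs ! s, vs ! t}" using chord_positions[OF f] .
  obtain m where m: "link ends (set es) m (vs ! t) (vs ! i)" "even m \<longleftrightarrow> even (t + i)"
    using position_link[of t i] ij st by auto
  obtain n where n: "link ends (set es) n (vs ! j) (vs ! s)" "even n \<longleftrightarrow> even (j + s)"
    using position_link[of j s] ij st by auto
  \<comment> \<open>The first link ends at position \<open>i\<close>, the second starts at position
    \<open>j\<close>. This change of position at the repeated vertex flips the parity.\<close>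
  have "link ends (set es) (m + n) (vs ! t) (vs ! s)" using link_trans m n ij by metis
  then have "link ends (G\<^sub>w - {f}) (m + n) (vs ! t) (vs ! s)"
    using f by (rule chord_free_link)
  then have "even (m + n)" using no_odd_link_around_chord[OF f st(3)] by blast
  moreover have "even (s + t)" using chord_even_distance[OF f _ _ st(3)] st by simp
  ultimately show False using m(2) n(2) odd by auto
qed

end

section \<open>Circuits: balanced weights on the walk and on an odd chord\<close>

locale circuit_walk = even_walk ends vs es K
  for ends :: "'e::finite \<Rightarrow> 'v::finite set" and vs :: "'v list" and es :: "'e list"
    and K :: "'k::field itself" +
  assumes circuit: "is_circuit ends B"
begin

lemma irr: "irreducible (monomial a - monomial b :: ('e, 'k) edge_poly)"
  using circuit by (simp add: is_circuit_def walk_binomial_eq)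

text \<open>Eliminating one edge of \<open>w\<close> from \<open>y\<close> by means of
  \<open>walk_net es\<close> leaves a balanced weight of smaller support, which is 0 for a circuit.
  So the two weights are proportional, and irreducibility makes the factor an integer.\<close>

lemma balanced_multiple:
  assumes bal: "balanced ends y" and supp: "\<And>e. y e \<noteq> 0 \<Longrightarrow> e \<in> set es"
  obtains k where "\<And>e. y e = k * walk_net es e"
proof (rule proportional_to_primitive[of "walk_net es" y])
  show "d dvd 1" if "\<And>e. d dvd walk_net es e" for d
    using irreducible_binomial_primitive[OF irr a_neq_0 b_neq_0] that by (simp add: walk_net_def)
  show "walk_net es e * y e' = walk_net es e' * y e" for e e'
  proof (cases "e \<in> set es")
    case False
    then show ?thesis using supp[of e] walk_net_eq_0[OF walkD(1) False] by auto
  next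
    case True
    \<comment> \<open>The coefficients are chosen so that \<open>z\<close> vanishes at
      \<open>e\<close>.\<close>
    define z where "z c = walk_net es e * y c - y e * walk_net es c" for c
    have "balanced ends z" unfolding z_def by (rule balanced_diff[OF bal net_balanced])
    have z: "c \<in> set es \<and> c \<noteq> e" if "z c \<noteq> 0" for c
    proof
      show "c \<in> set es"
      proof (rule ccontr)
        assume "c \<notin> set es"
        then have "y c = 0" "walk_net es c = 0" using supp[of c] walk_net_eq_0[OF walkD(1)] by auto
        then show False using that by (simp add: z_def)
      qed
      show "c \<noteq> e" using that by (auto simp: z_def)
    qed
    obtain u v where uv: "net u v = z" "\<And>c. Poly_Mapping.lookup u c = nat (z c)"
      "\<And>c. Poly_Mapping.lookup v c = nat (- z c)" using exponents_of_weight[of z] by blast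
    have "u = v"
    proof (rule ccontr)
      assume "u \<noteq> v"
      let ?B' = "monomial u - monomial v :: ('e, 'k) edge_poly"
      have "poly_supp ?B' \<subseteq> {c. z c \<noteq> 0}"
        using \<open>u \<noteq> v\<close> by (auto simp: poly_supp_binomial uv)
      also have "\<dots> \<subseteq> set es - {e}" using z by blast
      finally have "poly_supp ?B' \<subset> poly_supp B" using True by (auto simp: B_supp)
      moreover have "?B' \<noteq> 0" using \<open>u \<noteq> v\<close> by (simp add: monomial_eq_iff)
      moreover have "?B' \<in> toric_ideal ends"
        using \<open>balanced ends z\<close> by (simp add: binomial_in_toric_ideal_iff uv)
      moreover have "is_binomial ?B'" by (auto simp: is_binomial_def)
      ultimately show False using circuit unfolding is_circuit_def by blast
    qed
    then have "z e' = 0" using uv(1) by (metis net_eq_0_iff)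
    then show ?thesis by (simp add: z_def mult.commute)
  qed
qed (rule that)

lemma dvd_walk_binomial:
  assumes w': "even_closed_walk ends vs' es'" and supp: "\<And>e. walk_net es' e \<noteq> 0 \<Longrightarrow> e \<in> set es"
  shows "B dvd walk_binomial es'"
proof -
  obtain k where "\<And>e. walk_net es' e = k * walk_net es e"
    using balanced_multiple[OF balanced_walk_net[OF simple w'] supp] by blast
  then show ?thesis
    unfolding walk_binomial_eq using irreducible_binomial_coprime[OF irr]
    by (intro net_multiple_imp_binomial_dvd) (auto simp: walk_net_def)
qed

text \<open>Weighting the vertices of the cycle by alternating signs annihilates every edge of the cycle,
  but not an odd chord.\<close>

lemma cycle_odd_chord_weight:
  assumes cycle: "is_cycle ends vs es" and f: "odd_chord ends vs es f"
    and bal: "balanced ends y" and supp: "\<And>e. y e \<noteq> 0 \<Longrightarrow> e \<in> set es \<or> e = f"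
  shows "y f = 0"
proof -
  have inj: "i = j" if "i < len" "j < len" "vs ! i = vs ! j" for i j
    using cycle that walkD(3) by (auto simp: is_cycle_def distinct_conv_nth nth_butlast)
  \<comment> \<open>On a cycle each vertex has exactly one position below \<open>len\<close>, so the
    sum has a single nonzero term.\<close>
  define \<sigma> :: "'v \<Rightarrow> int" where "\<sigma> v = (\<Sum>i<len. if vs ! i = v then (-1) ^ i else 0)" for v
  have sig: "\<sigma> (vs ! i) = (-1) ^ i" if "i < len" for i
  proof -
    have "\<sigma> (vs ! i) = (\<Sum>j<len. if j = i then (-1) ^ i else 0)"
      unfolding \<sigma>_def using inj that by (intro sum.cong) auto
    then show ?thesis using that by simp
  qed
  then have sig': "\<sigma> (vs ! i) = (-1) ^ i" if "i \<le> len" for i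
    using that walkD(1,5) len_pos by (cases "i = len") auto
  have edge: "(\<Sum>v\<in>ends e. \<sigma> v) = 0" if e_in: "e \<in> set es" for e
  proof -
    obtain k where k: "k < len" "e = es ! k" using e_in by (auto simp: in_set_conv_nth)
    then have e: "ends e = {vs ! k, vs ! Suc k}" using walkD(4) by simp
    with ends_neq[OF simple e] show ?thesis using k sig'[of k] sig'[of "Suc k"] by simp
  qed
  obtain i j where ij: "i < j" "j < len" "ends f = {vs ! i, vs ! j}" "even (j - i)"
    using f by (auto simp: odd_chord_iff)
  have chord: "(\<Sum>v\<in>ends f. \<sigma> v) = 2 * (-1) ^ i"
    using ends_neq[OF simple ij(3)] ij sig[of i] sig[of j] by (auto simp: minus_one_power_iff)
  \<comment> \<open>Summing the balance conditions with weights \<open>\<sigma>\<close> and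
    exchanging the sums leaves only the term of \<open>f\<close>, which is \<open>y f\<close> times
    2 or -2.\<close>
  have "0 = (\<Sum>v\<in>UNIV. \<sigma> v * (\<Sum>e | v \<in> ends e. y e))"
    using bal by (simp add: balanced_def)
  also have "\<dots> = (\<Sum>v\<in>UNIV. \<Sum>e\<in>UNIV. if v \<in> ends e then \<sigma> v * y e else 0)"
    by (simp add: sum_distrib_left sum.If_cases)
  also have "\<dots> = (\<Sum>e\<in>UNIV. \<Sum>v\<in>UNIV. if v \<in> ends e then \<sigma> v * y e else 0)"
    by (rule sum.swap)
  also have "\<dots> = (\<Sum>e\<in>UNIV. y e * (\<Sum>v\<in>ends e. \<sigma> v))"
    by (simp add: sum_distrib_left sum.If_cases mult.commute)
  also have "\<dots> = (\<Sum>e\<in>UNIV. if e = f then y f * (2 * (-1) ^ i) else 0)"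
    using supp edge chord by (intro sum.cong) auto
  finally show ?thesis by simp
qed

end

section \<open>Characterisation of fundamental binomials\<close>

text \<open>A fundamental binomial comes from some fundamental walk, which may differ from the given
  one. Its support, however, determines the edges of the walk, thus its vertices and the induced
  subgraph.\<close>

lemma fundamental_binomial_iff:
  assumes "simple_graph ends" and "even_closed_walk ends vs es"
    and "(walk_binomial es :: ('e::finite, 'k::field) edge_poly) \<noteq> 0"
  shows "fundamental_binomial ends (walk_binomial es :: ('e, 'k) edge_poly) \<longleftrightarrow>
    (\<forall>vs' es'. even_closed_walk ends vs' es' \<and> set es' \<subseteq> induced_edges ends (set vs) \<longrightarrow>
       (walk_binomial es :: ('e, 'k) edge_poly) dvd walk_binomial es')"
proof -
  interpret even_walk ends vs es "TYPE('k)"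
    using assms by unfold_locales
  show ?thesis
  proof
    assume "fundamental_binomial ends B"
    then obtain vs0 es0 where w0: "fundamental_walk TYPE('k) ends vs0 es0"
      and B: "B = walk_binomial es0"
      unfolding fundamental_binomial_def by blast
    have "even_closed_walk ends vs0 es0" using w0 by (simp add: fundamental_walk_def)
    then interpret w0: even_walk ends vs0 es0 "TYPE('k)"
      using simple nonzero B by unfold_locales auto
    have "set es0 = set es" using w0.B_supp B_supp B by simp
    then have "set vs0 = set vs" by (simp add: w0.set_vs set_vs)
    then show "\<forall>vs' es'. even_closed_walk ends vs' es' \<and> set es' \<subseteq> G\<^sub>w \<longrightarrow> B dvd walk_binomial es'"
      using w0 unfolding fundamental_walk_def ideal_gen_singleton B[symmetric] mem_Collect_eq by simp blast
  next
    assume "\<forall>vs' es'. even_closed_walk ends vs' es' \<and> set es' \<subseteq> G\<^sub>w \<longrightarrow> B dvd walk_binomial es'"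
    then have "fundamental_walk TYPE('k) ends vs es"
      using walk unfolding fundamental_walk_def ideal_gen_singleton mem_Collect_eq by blast
    then show "fundamental_binomial ends B" unfolding fundamental_binomial_def by blast
  qed
qed

theorem theorem4p15:
  fixes ends :: "'e::finite \<Rightarrow> 'v::finite set"
    and vs :: "'v list" and es :: "'e list"
  assumes "simple_graph ends" and "connected_graph ends"
    and "even_closed_walk ends vs es"
    and "(walk_binomial es :: ('e, 'k::field) edge_poly) \<noteq> 0"
  shows "fundamental_binomial ends (walk_binomial es :: ('e, 'k) edge_poly) \<longleftrightarrow>
    is_circuit ends (walk_binomial es :: ('e, 'k) edge_poly) \<and>
    (if is_cycle ends vs es
     then (\<forall>f. \<not> even_chord ends vs es f) \<and> card {f. odd_chord ends vs es f} \<le> 1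
     else (\<forall>f. \<not> chord ends vs es f))"
proof -
  interpret even_walk ends vs es "TYPE('k)"
    using assms by unfold_locales
  show ?thesis
  proof
    assume "fundamental_binomial ends B"
    then interpret fundamental_even_walk ends vs es "TYPE('k)"
      using fundamental_binomial_iff[OF simple walk nonzero] by unfold_locales blast
    have "card {f. odd_chord ends vs es f} \<le> 1"
      using at_most_one_chord by (auto simp: card_le_Suc0_iff_eq odd_chord_iff)
    then show "is_circuit ends B \<and> (if is_cycle ends vs es
        then (\<forall>f. \<not> even_chord ends vs es f) \<and> card {f. odd_chord ends vs es f} \<le> 1
        else (\<forall>f. \<not> chord ends vs es f))"
      using circuit no_even_chord no_chord_unless_cycle by simp
  next
    assume rhs: "is_circuit ends B \<and> (if is_cycle ends vs es
        then (\<forall>f. \<not> even_chord ends vs es f) \<and> card {f. odd_chord ends vs es f} \<le> 1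
        else (\<forall>f. \<not> chord ends vs es f))"
    then interpret circuit_walk ends vs es "TYPE('k)" by unfold_locales blast
    have "B dvd walk_binomial es'"
      if w': "even_closed_walk ends vs' es'" and sub: "set es' \<subseteq> G\<^sub>w" for vs' es'
    proof (rule dvd_walk_binomial[OF w'])
      have edge_or_chord: "e \<in> set es \<or> chord ends vs es e" if "walk_net es' e \<noteq> 0" for e
        using that sub walk_net_eq_0[OF even_closed_walkD(1)[OF w'], of e]
        by (auto simp: chord_def induced_edges_def)
      fix e assume e: "walk_net es' e \<noteq> 0"
      show "e \<in> set es"
      proof (rule ccontr)
        assume "e \<notin> set es"
        then have "chord ends vs es e" using edge_or_chord[OF e] by blast
        then have cycle: "is_cycle ends vs es" and no_even: "\<And>f. \<not> even_chord ends vs es f"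
          and card: "card {f. odd_chord ends vs es f} \<le> 1"
          using rhs by (auto split: if_splits)
        have odd: "odd_chord ends vs es f" if "chord ends vs es f" for f
          using chord_parity[OF that] no_even by blast
        \<comment> \<open>Any other edge of nonzero weight outside \<open>w\<close> would be a
          second odd chord.\<close>
        have "c \<in> set es \<or> c = e" if "walk_net es' c \<noteq> 0" for c
          using edge_or_chord[OF that] odd[of c] odd[OF \<open>chord ends vs es e\<close>] card
          by (auto simp: card_le_Suc0_iff_eq)
        then have "walk_net es' e = 0"
          using cycle_odd_chord_weight[OF cycle odd[OF \<open>chord ends vs es e\<close>]
              balanced_walk_net[OF simple w']] by blast
        then show False using e by blast
      qed
    qed
    then show "fundamental_binomial ends B"
      unfolding fundamental_binomial_iff[OF simple walk nonzero] by blast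
  qed
qed

end
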